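(* (i) Let $n,m\ge 0$ be integers with $n\le m+1$, let $a_1,\ldots,a_n$ be complex, let $b_1,\ldots,b_m$ be complex with positive real parts, assume $\operatorname{Re}\left(\sum_{j=1}^m b_j-\sum_{j=1}^n a_j\right)>0$, and let $f,d$ be positive reals. Then $$1=\sum_{j\ge 0}\frac{(-1)^j}{(f)^{(j)}}\,\frac{\prod_{s=1}^n(a_s)^{(j)}}{\prod_{s=1}^m(b_s)^{(j)}\,(d+f+j-1)^{(j)}}\;{}_{n+1}F_{m+1}\left(\begin{array}{cccc}a_1+j&\ldots&a_n+j&f+j\\ b_1+j&\ldots&b_m+j&d+f+2j\end{array};1\right)$$ and $${}_nF_m\left(\begin{array}{ccc}a_1&\ldots&a_n\\ b_1&\ldots&b_m\end{array};1\right)=\sum_{j\ge 0}\frac{1}{(d)^{(j)}}\,\frac{\prod_{s=1}^n(a_s)^{(j)}}{\prod_{s=1}^m(b_s)^{(j)}\,(d+f+j-1)^{(j)}}\;{}_{n+1}F_{m+1}\left(\begin{array}{cccc}a_1+j&\ldots&a_n+j&f+j\\ b_1+j&\ldots&b_m+j&d+f+2j\end{array};1\right).$$ (ii) (Case $n=2$, $m=1$.) Let $a,b$ be complex and $c,d$ real with $c>0$, $d>0$, $c+d\ne 1$ and $\operatorname{Re}(c-a-b)>0$. Then $$1=\frac{\Gamma(c+d-1)\Gamma(c+d-a-b)}{\Gamma(c+d-a)\Gamma(c+d-b)}\sum_{j\ge 0}(-1)^j\frac{(a)^{(j)}(b)^{(j)}(c+d-1)^{(j)}(c+d+2j-1)}{j!\,(d+c-a)^{(j)}(d+c-b)^{(j)}}$$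 and $$\frac{\Gamma(c)\Gamma(c-a-b)}{\Gamma(c-a)\Gamma(c-b)}=\frac{\Gamma(c+d-1)\Gamma(c+d-a-b)}{\Gamma(c+d-a)\Gamma(c+d-b)}\sum_{j\ge 0}\frac{(d)^{(j)}(a)^{(j)}(b)^{(j)}(c+d-1)^{(j)}(c+d+2j-1)}{j!\,(c)^{(j)}(d+c-a)^{(j)}(d+c-b)^{(j)}}.$$ (iii) Let $n\ge 0$ be an integer. For all complex $c,b,f$ such that $c-b-f$ is not equal to a non-negative integer less than or equal to $n+1$, $$(c)^{(n)}=\sum_{j=0}^n(-1)^j\binom{n}{j}\frac{(b)^{(j)}(f)^{(j)}(c-b)^{(n-j)}(c-f)^{(n-j)}(c-b-f+n-2j)}{(c-b-f-j)^{(n+1)}}$$ and $$1=\sum_{j=0}^n(-1)^j\binom{n}{j}\frac{(b)^{(j)}(c-f)^{(n-j)}(c-b-f+n-2j)}{(c-b-f-j)^{(n+1)}}.$$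
   Context: Rising factorial: $(x)^{(n)}=x(x+1)\cdots(x+n-1)$, $(x)^{(0)}=1$. $\Gamma$ is Euler's gamma function. Generalized hypergeometric function: ${}_nF_m\left(\begin{array}{ccc} a_1&\ldots&a_n\\ b_1&\ldots&b_m\end{array};x\right)=\sum_{j\ge 0}\frac{\prod_{k=1}^n (a_k)^{(j)}}{\prod_{k=1}^m (b_k)^{(j)}}\frac{x^j}{j!}$.
   Formalization: (i) uses (-1)^j(f)^(j)/j! and (d)^(j)/j! for the false printed coefficients; first identities of (i),(ii) need n≤m, a nonpositive-integer a_s, or f<d+1+2Re(Σb-Σa) (f=c in (ii)); (ii) bars c+d-a, c+d-b nonpositive integers; (iii) needs nonzero denominators. *)

theory Defs
  imports "HOL-Analysis.Analysis"
begin

text \<open>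
  The parameters of the upper and the lower row are given as lists, so that their numbers are the
  lengths of the lists and the empty rows are covered. The value is taken in the sense of
  \<^const>\<open>suminf\<close>; in particular the argument \<open>x\<close> may lie on the circle of convergence.
\<close>

definition hypergeom :: "complex list \<Rightarrow> complex list \<Rightarrow> complex \<Rightarrow> complex" where
  "hypergeom as bs x =
     (\<Sum>j. (\<Prod>a\<leftarrow>as. pochhammer a j) / (\<Prod>b\<leftarrow>bs. pochhammer b j) * (x ^ j / fact j))"

lemma hypergeom_eq_eval_fps: "hypergeom as bs x = eval_fps (fps_hypergeo as bs 1) x"
proof -
  have foldl_eq: "foldl (\<lambda>r a. r * pochhammer a n) y cs = y * (\<Prod>a\<leftarrow>cs. pochhammer a n)"
    for n and y :: complex and cs
    by (induction cs arbitrary: y) (simp_all add: mult_ac)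
  show ?thesis
    by (simp add: hypergeom_def eval_fps_def foldl_eq)
qed

end

theory Submission
  imports Defs "HOL-Real_Asymp.Real_Asymp"
begin

text \<open>
  Write \<open>(x)_j\<close> for the rising factorial, \<open>e = d + f - 1\<close>, and \<open>u k\<close> for the \<open>k\<close>-th coefficient of
  the series on the left of (i). Inserting the inner series and collecting the coefficient of \<open>u k\<close>
  reduces both identities of (i) to finite sums over \<open>j \<le> k\<close> with the weights
  \<open>(k choose j) / ((e + j)_j (e + 2 j + 1)_(k - j))\<close>. By Pascal's rule such a weight splits into
  two adjacent terms, and summation by parts gives a recursion \<open>(k, e) \<rightarrow> (k - 1, e + 1)\<close>
  which evaluates all finite sums needed, those of (iii) included.

  For the second identity of (i) the weights are nonnegative with sum 1, so dominated convergence
  applies. The first one need not converge absolutely as a double series, but its partial sums have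
  the closed form \<open>(-1)^M (k - 1 choose M) / (e + 1 + M)_k\<close>. Bounding \<open>u k (f)_k\<close> by a multiple of
  \<open>(p)_k\<close> makes the remainder a Gauss series with value \<open>(p)_N / (e - p)_N\<close>, \<open>N = M + 1\<close>, which
  tends to 0 because \<open>2 p < e\<close>; this is where the upper bound on \<open>f\<close> enters.
  Part (ii) is (i) with \<open>f = c\<close> and the inner series summed by Gauss's theorem.
\<close>

subsection \<open>Growth of Pochhammer symbols and hypergeometric coefficients\<close>

text \<open>Gauss's limit \<open>(n - 1)! n^z / (z)_n -> Gamma z\<close> fixes the growth of
  \<open>(z)_n\<close>. It can be inverted because Gamma has no zeros off its poles; at a
  nonpositive integer the symbol vanishes eventually and the bound is trivial.\<close>

lemma norm_pochhammer_bigo: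
  "(\<lambda>n. norm (pochhammer (z::complex) n)) \<in> O(\<lambda>n. fact (n - 1) * real n powr Re z)"
proof (cases "z \<in> \<int>\<^sub>\<le>\<^sub>0")
  case True
  then obtain m where z: "z = - of_nat m" by (auto elim: nonpos_Ints_cases')
  have "eventually (\<lambda>n. norm (pochhammer z n) = 0) at_top"
    using eventually_gt_at_top[of m]
    by eventually_elim (simp add: z pochhammer_of_nat_eq_0_lemma)
  then show ?thesis
    by (subst landau_o.big.in_cong[of _ "\<lambda>_. 0"]) auto
next
  case False
  have "(\<lambda>n. inverse (Gamma_series' z n)) \<longlonglongrightarrow> inverse (Gamma z)"
    using False by (intro tendsto_intros Gamma_series'_LIMSEQ) (auto simp: Gamma_eq_zero_iff)
  moreover have "\<forall>\<^sub>F n in sequentially. norm (inverse (Gamma_series' z n)) =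
      norm (pochhammer z n) / (fact (n - 1) * real n powr Re z)"
    using eventually_gt_at_top[of 0]
    by eventually_elim
       (simp add: Gamma_series'_def norm_mult norm_divide norm_inverse powr_def)
  ultimately have "(\<lambda>n. norm (pochhammer z n) / (fact (n - 1) * real n powr Re z))
      \<longlonglongrightarrow> norm (inverse (Gamma z))"
    using tendsto_norm tendsto_cong by fast
  then show ?thesis
    by (rule bigoI_tendsto) (auto intro!: eventually_mono[OF eventually_gt_at_top[of 0]])
qed

text \<open>The same limit without inversion, to be used for denominators. Nonpositive integers are
  excluded because \<open>(z)_n\<close> is eventually 0 there.\<close>

lemma pochhammer_in_bigomega:
  assumes "(z::complex) \<notin> \<int>\<^sub>\<le>\<^sub>0"
  shows "(\<lambda>n. fact (n - 1) * real n powr Re z) \<in> O(\<lambda>n. norm (pochhammer z n))"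
proof -
  have nz: "pochhammer z n \<noteq> 0" for n
    using assms pochhammer_eq_0_imp_nonpos_Int by blast
  have "(\<lambda>n. norm (Gamma_series' z n)) \<longlonglongrightarrow> norm (Gamma z)"
    by (intro tendsto_intros Gamma_series'_LIMSEQ)
  moreover have "\<forall>\<^sub>F n in sequentially. norm (Gamma_series' z n) =
      fact (n - 1) * real n powr Re z / norm (pochhammer z n)"
    using eventually_gt_at_top[of 0]
    by eventually_elim
       (simp add: Gamma_series'_def norm_mult norm_divide norm_inverse powr_def)
  ultimately have "(\<lambda>n. fact (n - 1) * real n powr Re z / norm (pochhammer z n))
      \<longlonglongrightarrow> norm (Gamma z)"
    using tendsto_cong by fast
  then show ?thesis
    by (rule bigoI_tendsto) (auto simp: nz)
qed

lemma prod_pochhammer_bigo: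
  "(\<lambda>n. norm (\<Prod>a\<leftarrow>as. pochhammer (a::complex) n))
     \<in> O(\<lambda>n. fact (n - 1) ^ length as * real n powr Re (sum_list as))"
proof (induction as)
  case Nil
  show ?case
    by (rule bigoI[of _ 1]) (auto intro!: eventually_mono[OF eventually_gt_at_top[of 0]])
next
  case (Cons a as)
  have "(\<lambda>n. norm (pochhammer a n) * norm (\<Prod>a\<leftarrow>as. pochhammer a n))
     \<in> O(\<lambda>n. (fact (n - 1) * real n powr Re a) * (fact (n - 1) ^ length as * real n powr Re (sum_list as)))"
    by (intro landau_o.big.mult norm_pochhammer_bigo Cons.IH)
  then show ?case
    by (simp add: norm_mult powr_add mult_ac)
qed

lemma prod_pochhammer_bigomega:
  assumes "\<forall>b\<in>set bs. (b::complex) \<notin> \<int>\<^sub>\<le>\<^sub>0"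
  shows "(\<lambda>n. fact (n - 1) ^ length bs * real n powr Re (sum_list bs))
     \<in> O(\<lambda>n. norm (\<Prod>b\<leftarrow>bs. pochhammer (b::complex) n))"
  using assms
proof (induction bs)
  case Nil
  show ?case
    by (rule bigoI[of _ 1]) (auto intro!: eventually_mono[OF eventually_gt_at_top[of 0]])
next
  case (Cons a as)
  have "(\<lambda>n. (fact (n - 1) * real n powr Re a) * (fact (n - 1) ^ length as * real n powr Re (sum_list as)))
     \<in> O(\<lambda>n. norm (pochhammer a n) * norm (\<Prod>a\<leftarrow>as. pochhammer a n))"
    using Cons.prems by (intro landau_o.big.mult pochhammer_in_bigomega Cons.IH) auto
  then show ?case
    by (simp add: norm_mult powr_add mult_ac)
qed

section \<open>Coefficients of generalized hypergeometric series at argument 1\<close>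

definition hypergeom_coeff :: "complex list \<Rightarrow> complex list \<Rightarrow> nat \<Rightarrow> complex" where
  "hypergeom_coeff as bs n =
     (\<Prod>a\<leftarrow>as. pochhammer a n) / (\<Prod>b\<leftarrow>bs. pochhammer b n) / fact n"

lemma hypergeom_coeff_0 [simp]: "hypergeom_coeff as bs 0 = 1"
proof -
  have "(\<Prod>a\<leftarrow>cs. pochhammer a 0) = (1::complex)" for cs
    by (induction cs) auto
  then show ?thesis by (simp add: hypergeom_coeff_def)
qed

lemma hypergeom_1: "hypergeom as bs 1 = (\<Sum>n. hypergeom_coeff as bs n)"
  by (simp add: hypergeom_def hypergeom_coeff_def)

lemma prod_pochhammer_nonzero:
  assumes "\<forall>b\<in>set bs. (b::complex) \<notin> \<int>\<^sub>\<le>\<^sub>0"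
  shows "(\<Prod>b\<leftarrow>bs. pochhammer b n) \<noteq> 0"
  using assms by (induction bs) (auto dest: pochhammer_eq_0_imp_nonpos_Int)

text \<open>With \<open>t = Re (sum_list bs - sum_list as)\<close> and \<open>la\<close>,
  \<open>lb\<close> the lengths, the coefficient is at most of order
  \<open>(n - 1)!^(la - lb) n^(-t) / n!\<close>. For \<open>la = lb + 1\<close> the factorials leave
  \<open>1 / n\<close>, hence the exponent \<open>- t - 1\<close>. For \<open>la <= lb\<close> the
  factorial beats every power, and a nonpositive integer in \<open>as\<close> makes the series
  terminate; in these two cases \<open>s\<close> is arbitrary, which
  \<open>sums_one_coefficient_times_hypergeom\<close> exploits.\<close>

lemma hypergeom_coeff_bigo:
  assumes bs: "\<forall>b\<in>set bs. b \<notin> \<int>\<^sub>\<le>\<^sub>0"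
  assumes "length as \<le> length bs \<or> (\<exists>a\<in>set as. a \<in> \<int>\<^sub>\<le>\<^sub>0) \<or>
           length as = length bs + 1 \<and> s \<le> Re (sum_list bs - sum_list as)"
  shows "(\<lambda>n. norm (hypergeom_coeff as bs n)) \<in> O(\<lambda>n. real n powr (- s - 1))"
proof (cases "\<exists>a\<in>set as. a \<in> \<int>\<^sub>\<le>\<^sub>0")
  case True
  then obtain m where m: "- of_nat m \<in> set as" by (auto elim!: nonpos_Ints_cases')
  have "eventually (\<lambda>n. norm (hypergeom_coeff as bs n) = 0) at_top"
    using eventually_gt_at_top[of m]
  proof eventually_elim
    case (elim n)
    then have "(\<Prod>a\<leftarrow>as. pochhammer a n) = 0"
      using m pochhammer_of_nat_eq_0_lemma[of m n, where ?'a = complex]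
      by (force simp: prod_list_zero_iff)
    then show ?case by (simp add: hypergeom_coeff_def)
  qed
  then show ?thesis
    by (subst landau_o.big.in_cong[of _ "\<lambda>_. 0"]) auto
next
  case False
  define t where "t = Re (sum_list bs - sum_list as)"
  define la lb where "la = length as" and "lb = length bs"
  have "(\<lambda>n. norm (\<Prod>a\<leftarrow>as. pochhammer a n) / norm (\<Prod>b\<leftarrow>bs. pochhammer b n) / fact n)
    \<in> O(\<lambda>n. (fact (n - 1) ^ la * real n powr Re (sum_list as))
           / (fact (n - 1) ^ lb * real n powr Re (sum_list bs)) / fact n)"
    unfolding la_def lb_def
    by (intro landau_o.big.divide prod_pochhammer_bigo prod_pochhammer_bigomega bs)
       (auto simp: prod_pochhammer_nonzero[OF bs] intro!: eventually_mono[OF eventually_gt_at_top[of 0]])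
  also have "(\<lambda>n. norm (\<Prod>a\<leftarrow>as. pochhammer a n) / norm (\<Prod>b\<leftarrow>bs. pochhammer b n) / fact n)
      = (\<lambda>n. norm (hypergeom_coeff as bs n))"
    by (simp add: hypergeom_coeff_def norm_divide norm_mult)
  also have "(\<lambda>n. (fact (n - 1) ^ la * real n powr Re (sum_list as))
           / (fact (n - 1) ^ lb * real n powr Re (sum_list bs)) / fact n)
     = (\<lambda>n. fact (n - 1) ^ la / fact (n - 1) ^ lb * real n powr (- t) / fact n)"
    by (rule ext) (simp add: t_def powr_minus powr_diff field_simps)
  also have "\<dots> \<in> O(\<lambda>n. real n powr (- s - 1))"
  proof (cases "la \<le> lb")
    case True
    have "(\<lambda>n. fact (n - 1) ^ la / fact (n - 1) ^ lb * real n powr (- t) / fact n)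
        \<in> O(\<lambda>n. real n powr (- t) / fact n)"
    proof (rule bigoI[of _ 1], rule always_eventually, rule allI)
      fix n :: nat
      have "(fact (n - 1) :: real) ^ la \<le> fact (n - 1) ^ lb"
        using True by (intro power_increasing) auto
      then show "norm (fact (n - 1) ^ la / fact (n - 1) ^ lb * real n powr (- t) / fact n)
          \<le> 1 * norm (real n powr (- t) / fact n)"
        by (auto simp: field_simps intro!: mult_left_mono)
    qed
    also have "(\<lambda>n. real n powr (- t) / fact n) \<in> O(\<lambda>n. real n powr (- s - 1))"
    proof -
      \<comment> \<open>The factorial is traded for \<open>2 ^ n\<close>: the quotients
        \<open>2 ^ n / n!\<close> are terms of the exponential series, hence bounded, and only
        powers against \<open>2 ^ n\<close> remain to be compared.\<close>
      have "(\<lambda>n. inverse (fact n) * 2 ^ n :: real) \<in> O(\<lambda>_. 1)"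
        using bigoI_tendsto[of "\<lambda>n. inverse (fact n) * 2 ^ n :: real" "\<lambda>_. 1" 0 sequentially]
          summable_LIMSEQ_zero[OF summable_exp[of "2 :: real"]] by simp
      then have "(\<lambda>n. (real n powr (- t) / 2 ^ n) * (inverse (fact n) * 2 ^ n))
          \<in> O(\<lambda>n. (real n powr (- t) / 2 ^ n) * 1)"
        by (intro landau_o.big.mult landau_o.big_refl)
      also have "(\<lambda>n. (real n powr (- t) / 2 ^ n) * 1) \<in> O(\<lambda>n. real n powr (- s - 1))"
        by real_asymp
      finally show ?thesis by (simp add: field_simps)
    qed
    finally show ?thesis .
  next
    case la: False
    with assms False have *: "la = lb + 1" "s \<le> t" by (auto simp: la_def lb_def t_def)
    show ?thesis
    proof (rule bigoI[of _ 1], rule eventually_mono[OF eventually_gt_at_top[of 0]])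
      fix n :: nat assume n: "n > 0"
      have "fact (n - 1) ^ la / fact (n - 1) ^ lb * real n powr (- t) / fact n = real n powr (- t - 1)"
        using n fact_reduce[of n, where ?'a = real] by (simp add: * powr_diff field_simps)
      also have "\<dots> \<le> real n powr (- s - 1)" using n * by (intro powr_mono) auto
      finally show "norm (fact (n - 1) ^ la / fact (n - 1) ^ lb * real n powr (- t) / fact n)
          \<le> 1 * norm (real n powr (- s - 1))" by simp
    qed
  qed
  finally show ?thesis .
qed

lemma summable_norm_hypergeom_coeff:
  assumes "\<forall>b\<in>set bs. b \<notin> \<int>\<^sub>\<le>\<^sub>0"
  assumes "length as \<le> length bs + 1" "Re (sum_list bs - sum_list as) > 0"
  shows "summable (\<lambda>n. norm (hypergeom_coeff as bs n))"
proof (rule summable_comparison_test_bigo)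
  have "summable (\<lambda>n. real n powr (- Re (sum_list bs - sum_list as) - 1))"
    using assms(3) by (subst summable_real_powr_iff) auto
  then show "summable (\<lambda>n. norm (real n powr (- Re (sum_list bs - sum_list as) - 1)))" by simp
  show "(\<lambda>n. norm (hypergeom_coeff as bs n)) \<in> O(\<lambda>n. real n powr (- Re (sum_list bs - sum_list as) - 1))"
    using assms by (intro hypergeom_coeff_bigo) auto
qed

subsection \<open>Gauss's summation theorem\<close>

definition gauss_term :: "complex \<Rightarrow> complex \<Rightarrow> complex \<Rightarrow> nat \<Rightarrow> complex" where
  "gauss_term a b c k = pochhammer a k * pochhammer b k / (pochhammer c k * fact k)"

lemma hypergeom_coeff_2_1: "hypergeom_coeff [a, b] [c] k = gauss_term a b c k"
  by (simp add: hypergeom_coeff_def gauss_term_def)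

lemma Re_pos_notin_nonpos_Ints: "Re z > 0 \<Longrightarrow> z \<notin> \<int>\<^sub>\<le>\<^sub>0"
  by (auto elim!: nonpos_Ints_cases)

lemma summable_norm_gauss_term:
  assumes "Re c > 0" "Re (c - a - b) > 0"
  shows "summable (\<lambda>k. norm (gauss_term a b c k))"
  using summable_norm_hypergeom_coeff[of "[c]" "[a, b]"] assms Re_pos_notin_nonpos_Ints[of c]
  by (simp add: hypergeom_coeff_2_1 algebra_simps)

lemma bigo_tendsto_0:
  fixes f g :: "nat \<Rightarrow> real"
  assumes "f \<in> O(g)" "g \<longlonglongrightarrow> 0"
  shows "f \<longlonglongrightarrow> 0"
proof -
  have "g \<in> o(\<lambda>_. 1)"
    using assms(2) by (intro smalloI_tendsto) auto
  with assms(1) have "f \<in> o(\<lambda>_. 1)"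
    by (rule landau_o.big_small_trans)
  from smalloD_tendsto[OF this] show ?thesis by simp
qed

text \<open>Termwise, left side minus right side is \<open>k u_k - (k + 1) u_(k + 1)\<close>. This
  telescopes to 0, because \<open>k u_k\<close> is 0 at \<open>k = 0\<close> and tends to 0 by the
  decay \<open>u_k = O(k^(- Re (c - a - b) - 1))\<close>.\<close>

lemma gauss_contiguous:
  assumes c: "Re c > 0" and s: "Re (c - a - b) > 0"
  shows "(c - a - b) * (\<Sum>k. gauss_term a b c k)
       = (c - a) * (c - b) / c * (\<Sum>k. gauss_term a b (c + 1) k)"
proof -
  define u where "u = gauss_term a b c"
  define v where "v = gauss_term a b (c + 1)"
  have nz: "c + of_nat k \<noteq> 0" for k
    using c by (auto simp: complex_eq_iff)
  have pnz: "pochhammer c k \<noteq> 0" for k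
    using Re_pos_notin_nonpos_Ints[OF c] pochhammer_eq_0_imp_nonpos_Int by blast
  have v: "v k = u k * (c / (c + of_nat k))" for k
  proof -
    have "c * pochhammer (c + 1) k = (c + of_nat k) * pochhammer c k"
      by (metis pochhammer_rec pochhammer_rec')
    then have "pochhammer (c + 1) k = (c + of_nat k) * pochhammer c k / c"
      using nz[of 0] by (simp add: field_simps)
    then show ?thesis by (simp add: u_def v_def gauss_term_def)
  qed
  have u_Suc: "of_nat (Suc k) * u (Suc k) = u k * ((a + of_nat k) * (b + of_nat k) / (c + of_nat k))" for k
  proof -
    have "S * (x * A * (y * B) / (z * C * (S * F))) = A * B / (C * F) * (x * y / z)"
      if "S \<noteq> 0" for x y z A B C S F :: complex
      using that by (simp add: mult_ac)
    then show ?thesis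
      unfolding u_def gauss_term_def pochhammer_rec' fact_Suc
      using of_nat_neq_0[of k, where ?'a = complex] by blast
  qed
  have tele: "of_nat k * u k - of_nat (Suc k) * u (Suc k)
      = (c - a - b) * u k - (c - a) * (c - b) / c * v k" for k
  proof -
    have "of_nat k * u k - of_nat (Suc k) * u (Suc k)
      = u k * (of_nat k - (a + of_nat k) * (b + of_nat k) / (c + of_nat k))"
      unfolding u_Suc by (simp add: algebra_simps)
    \<comment> \<open>Partial fractions in \<open>k\<close>: the pole at \<open>k = -c\<close>
      produces exactly the factor \<open>c / (c + k)\<close> by which \<open>v\<close> differs from
      \<open>u\<close>.\<close>
    also have "of_nat k - (a + of_nat k) * (b + of_nat k) / (c + of_nat k)
       = (c - a - b) - (c - a) * (c - b) / (c + of_nat k)"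
      using nz[of k] by (simp add: field_simps)
    also have "u k * \<dots> = (c - a - b) * u k - (c - a) * (c - b) / c * v k"
    proof -
      have "x * (y - z / w) = y * x - z / c * (x * (c / w))" for x y z w
        using nz[of 0] by (simp add: right_diff_distrib mult_ac)
      then show ?thesis unfolding v .
    qed
    finally show ?thesis .
  qed
  have "(\<lambda>k. norm (u k)) \<in> O(\<lambda>k. real k powr (- Re (c - a - b) - 1))"
    using hypergeom_coeff_bigo[of "[c]" "[a, b]" "Re (c - a - b)"] Re_pos_notin_nonpos_Ints[OF c]
    by (simp add: hypergeom_coeff_2_1 u_def algebra_simps)
  then have "(\<lambda>k. real k * norm (u k)) \<in> O(\<lambda>k. real k * real k powr (- Re (c - a - b) - 1))"
    by (intro landau_o.big.mult) auto
  moreover have "(\<lambda>k. real k * real k powr (- Re (c - a - b) - 1)) \<longlonglongrightarrow> 0"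
    using s by real_asymp
  ultimately have "(\<lambda>k. real k * norm (u k)) \<longlonglongrightarrow> 0"
    by (rule bigo_tendsto_0)
  then have "(\<lambda>k. of_nat k * u k) \<longlonglongrightarrow> 0"
    by (intro tendsto_norm_zero_cancel[of "\<lambda>k. of_nat k * u k"]) (simp add: norm_mult)
  from telescope_sums'[OF this]
  have 1: "(\<lambda>k. (c - a - b) * u k - (c - a) * (c - b) / c * v k) sums 0"
    by (simp only: tele) simp
  have "u sums suminf u" "v sums suminf v"
    unfolding u_def v_def using c s
    by (auto intro!: summable_sums summable_norm_cancel[OF summable_norm_gauss_term])
  then have "(\<lambda>k. (c - a - b) * u k - (c - a) * (c - b) / c * v k) sums
      ((c - a - b) * suminf u - (c - a) * (c - b) / c * suminf v)"
    by (intro sums_diff sums_mult)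
  from sums_unique2[OF this 1] show ?thesis
    by (simp add: u_def v_def)
qed

text \<open>Kept free of division, so that the rising factorials can be normalised to the product
  formula for 1/Gamma before letting \<open>m\<close> tend to infinity.\<close>

lemma gauss_contiguous_iterate:
  assumes c: "Re c > 0" and s: "Re (c - a - b) > 0"
  shows "pochhammer c m * pochhammer (c - a - b) m * (\<Sum>k. gauss_term a b c k)
       = pochhammer (c - a) m * pochhammer (c - b) m * (\<Sum>k. gauss_term a b (c + of_nat m) k)"
proof (induction m)
  case (Suc m)
  have nz: "c + of_nat m \<noteq> 0"
    using c by (auto simp: complex_eq_iff)
  have "(c + of_nat m - a - b) * (\<Sum>k. gauss_term a b (c + of_nat m) k)
       = (c + of_nat m - a) * (c + of_nat m - b) / (c + of_nat m)
         * (\<Sum>k. gauss_term a b (c + of_nat m + 1) k)"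
    by (intro gauss_contiguous) (use c s in auto)
  then have *: "(c + of_nat m) * (c - a - b + of_nat m) * (\<Sum>k. gauss_term a b (c + of_nat m) k)
       = (c - a + of_nat m) * (c - b + of_nat m) * (\<Sum>k. gauss_term a b (c + of_nat (Suc m)) k)"
    using nz by (simp add: field_simps)
  have "pochhammer c (Suc m) * pochhammer (c - a - b) (Suc m) * (\<Sum>k. gauss_term a b c k)
      = (c + of_nat m) * (c - a - b + of_nat m) *
          (pochhammer c m * pochhammer (c - a - b) m * (\<Sum>k. gauss_term a b c k))"
    by (simp add: pochhammer_rec' mult_ac)
  also have "\<dots> = pochhammer (c - a) m * pochhammer (c - b) m *
     ((c + of_nat m) * (c - a - b + of_nat m) * (\<Sum>k. gauss_term a b (c + of_nat m) k))"
    unfolding Suc.IH by (simp only: mult_ac)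
  also have "\<dots> = pochhammer (c - a) (Suc m) * pochhammer (c - b) (Suc m) *
     (\<Sum>k. gauss_term a b (c + of_nat (Suc m)) k)"
    unfolding * by (simp add: pochhammer_rec' mult_ac)
  finally show ?case .
qed simp

text \<open>Every term with \<open>k > 0\<close> dies because its denominator tends to infinity. The
  series at \<open>m = 0\<close> dominates: \<open>Re c > 0\<close> implies that
  \<open>norm (c + i)\<close> grows under the shift by \<open>m\<close>, hence so does each factor
  of the denominator.\<close>

lemma gauss_term_shift_tendsto:
  assumes c: "Re c > 0" and s: "Re (c - a - b) > 0"
  shows "(\<lambda>m. \<Sum>k. gauss_term a b (c + of_nat m) k) \<longlonglongrightarrow> 1"
proof -
  have "(\<lambda>m. \<Sum>k. gauss_term a b (c + of_nat m) k) \<longlonglongrightarrow> (\<Sum>k. if k = 0 then 1 else 0)"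
  proof (rule tannerys_theorem[THEN conjunct2, THEN conjunct2])
    show "summable (\<lambda>k. norm (gauss_term a b c k))"
      by (rule summable_norm_gauss_term[OF c s])
    show "(\<lambda>m. gauss_term a b (c + of_nat m) k) \<longlonglongrightarrow> (if k = 0 then 1 else 0)" for k
    proof (cases k)
      case (Suc l)
      have "filterlim (\<lambda>m. pochhammer (c + of_nat m) (Suc i) * fact k) at_infinity sequentially" for i
      proof (induction i)
        case 0
        have "filterlim (\<lambda>m. c + of_nat m) at_infinity sequentially"
          by (intro tendsto_add_filterlim_at_infinity[OF tendsto_const] tendsto_of_nat)
        then have "filterlim (\<lambda>m. fact k * (c + of_nat m)) at_infinity sequentially"
          by (rule tendsto_mult_filterlim_at_infinity[OF tendsto_const, rotated]) simp
        then show ?case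
          by (simp add: mult.commute)
      next
        case (Suc i)
        have "filterlim (\<lambda>m. (c + of_nat (Suc i)) + of_nat m) at_infinity sequentially"
          by (intro tendsto_add_filterlim_at_infinity[OF tendsto_const] tendsto_of_nat)
        then have "filterlim (\<lambda>m. ((c + of_nat (Suc i)) + of_nat m) *
            (pochhammer (c + of_nat m) (Suc i) * fact k)) at_infinity sequentially"
          using Suc by (rule filterlim_at_infinity_times)
        then show ?case
          by (simp add: pochhammer_rec' algebra_simps)
      qed
      from tendsto_divide_0[OF tendsto_const this] show ?thesis
        by (simp add: gauss_term_def Suc)
    qed (simp add: gauss_term_def)
    show "\<forall>\<^sub>F (k, m) in sequentially \<times>\<^sub>F sequentially.
        norm (gauss_term a b (c + of_nat m) k) \<le> norm (gauss_term a b c k)"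
    proof (intro always_eventually allI, clarify)
      fix k m :: nat
      have "norm (pochhammer c k) \<le> norm (pochhammer (c + of_nat m) k)"
        unfolding pochhammer_prod prod_norm[symmetric]
      proof (intro prod_mono conjI norm_ge_zero)
        fix i
        have "(Re c + real i)\<^sup>2 \<le> (Re c + real m + real i)\<^sup>2"
          using c by (intro power_mono) auto
        then show "norm (c + of_nat i) \<le> norm (c + of_nat m + of_nat i)"
          by (auto simp: cmod_def)
      qed
      moreover have "pochhammer c k \<noteq> 0"
        using Re_pos_notin_nonpos_Ints[OF c] pochhammer_eq_0_imp_nonpos_Int by blast
      ultimately show "norm (gauss_term a b (c + of_nat m) k) \<le> norm (gauss_term a b c k)"
        unfolding gauss_term_def norm_divide norm_mult
        by (intro divide_left_mono mult_right_mono mult_nonneg_nonneg) (auto intro!: mult_pos_pos)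
    qed
  qed simp
  then show ?thesis
    using sums_single[of 0 "\<lambda>_. 1 :: complex"] by (simp add: sums_iff)
qed

text \<open>Limit of the iterated contiguous relation, where the shifted series tends to 1. In terms
  of \<open>rGamma\<close> the value is correct also when \<open>c - a\<close> or
  \<open>c - b\<close> is a nonpositive integer.\<close>

theorem gauss_summation:
  assumes c: "Re c > 0" and s: "Re (c - a - b) > 0"
  shows "(\<Sum>k. gauss_term a b c k) = Gamma c * Gamma (c - a - b) * rGamma (c - a) * rGamma (c - b)"
proof -
  define G where "G = (\<Sum>k. gauss_term a b c k)"
  have lim1: "(\<lambda>m. rGamma_series c m * rGamma_series (c - a - b) m * G)
      \<longlonglongrightarrow> rGamma c * rGamma (c - a - b) * G"
    by (intro tendsto_intros)
  have lim2: "(\<lambda>m. rGamma_series (c - a) m * rGamma_series (c - b) m *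
        (\<Sum>k. gauss_term a b (c + of_nat (Suc m)) k))
      \<longlonglongrightarrow> rGamma (c - a) * rGamma (c - b) * 1"
    by (intro tendsto_intros LIMSEQ_Suc[OF gauss_term_shift_tendsto] c s)
  \<comment> \<open>\<open>rGamma_series z m\<close> contains \<open>(z)_(m + 1)\<close>, so the
    relation is used at \<open>Suc m\<close>. The exponential factors agree on both sides because
    \<open>c + (c - a - b) = (c - a) + (c - b)\<close>.\<close>
  have eq: "rGamma_series c m * rGamma_series (c - a - b) m * G
      = rGamma_series (c - a) m * rGamma_series (c - b) m *
        (\<Sum>k. gauss_term a b (c + of_nat (Suc m)) k)" for m
  proof -
    define L :: complex where "L = of_real (ln (of_nat m))"
    have "exp (c * L) * exp ((c - a - b) * L) = exp ((c - a) * L) * exp ((c - b) * L)"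
      unfolding exp_add[symmetric] by (simp add: algebra_simps)
    then have "(fact m * exp (c * L)) * (fact m * exp ((c - a - b) * L))
        = (fact m * exp ((c - a) * L)) * (fact m * exp ((c - b) * L))"
      by (simp add: mult_ac)
    then show ?thesis
      using gauss_contiguous_iterate[OF c s, of "Suc m"]
      unfolding rGamma_series_def G_def L_def times_divide_times_eq times_divide_eq_left
      by (simp add: mult_ac)
  qed
  have *: "rGamma c * rGamma (c - a - b) * G = rGamma (c - a) * rGamma (c - b)"
    using LIMSEQ_unique[OF lim1[unfolded eq] lim2] by simp
  have "Gamma c * rGamma c = 1" "Gamma (c - a - b) * rGamma (c - a - b) = 1"
    using Re_pos_notin_nonpos_Ints[OF c] Re_pos_notin_nonpos_Ints[OF s]
    by (simp_all add: rGamma_inverse_Gamma Gamma_eq_zero_iff)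
  then have "(Gamma c * rGamma c) * (Gamma (c - a - b) * rGamma (c - a - b)) * G = G"
    by simp
  then have "Gamma c * Gamma (c - a - b) * (rGamma c * rGamma (c - a - b) * G) = G"
    by (simp only: mult_ac)
  then show ?thesis unfolding * by (simp add: G_def mult_ac)
qed

subsection \<open>Finite sums\<close>

text \<open>
  Generically this is \<open>(n choose j) (e + 2 j) / (e + j)_(n + 1)\<close>; the present form is also correct for
  \<open>j = 0\<close>, \<open>e = 0\<close>, which occurs in (i) when \<open>d + f = 1\<close>.
\<close>
definition gap_weight :: "'a::field_char_0 \<Rightarrow> nat \<Rightarrow> nat \<Rightarrow> 'a" where
  "gap_weight e n j = of_nat (n choose j) /
     (pochhammer (e + of_nat j) j * pochhammer (e + 2 * of_nat j + 1) (n - j))"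

text \<open>\<open>e + 2 j\<close> is the factor at position \<open>j\<close> of
  \<open>(e + j)_(n + 1)\<close>. Singled out, it cancels against the numerator of the generic
  weight and leaves the denominator of \<open>gap_weight\<close>.\<close>

lemma pochhammer_split_middle:
  fixes e :: "'a::comm_ring_1"
  assumes "j \<le> n"
  shows "pochhammer (e + of_nat j) (Suc n) =
    pochhammer (e + of_nat j) j * ((e + 2 * of_nat j) * pochhammer (e + 2 * of_nat j + 1) (n - j))"
proof -
  have "pochhammer (e + of_nat j) (Suc n) =
     pochhammer (e + of_nat j) j * pochhammer (e + of_nat j + of_nat j) (Suc n - j)"
    using assms by (intro pochhammer_product) auto
  also have "Suc n - j = Suc (n - j)" using assms by simp
  also have "e + of_nat j + of_nat j = e + 2 * of_nat j" by (simp only: mult_2 add.assoc)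
  finally show ?thesis by (simp only: pochhammer_rec)
qed

lemma gap_weight_altdef:
  assumes "e + 2 * of_nat j \<noteq> 0"
  shows "gap_weight e n j = of_nat (n choose j) * (e + 2 * of_nat j) / pochhammer (e + of_nat j) (Suc n)"
proof (cases "j \<le> n")
  case True
  then show ?thesis using assms
    unfolding gap_weight_def by (simp add: pochhammer_split_middle)
qed (simp add: gap_weight_def binomial_eq_0)

text \<open>By Pascal's rule and absorption, \<open>(n + 1 choose j) (e + 2 j) = (n choose j) (e +
  j) + (n choose j - 1) (e + j + n + 1)\<close>, and each summand cancels an end factor of
  \<open>(e + j)_(n + 2)\<close>. The result is \<open>A j + A (j - 1)\<close> for the single
  sequence \<open>A j = (n choose j) / (e + 1 + j)_(n + 1)\<close>. The hypothesis starts at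
  \<open>i = 1\<close>, so \<open>e = 0\<close> is allowed.\<close>

lemma gap_weight_Suc:
  fixes e :: "'a::field_char_0"
  assumes nz: "\<And>i. 1 \<le> i \<Longrightarrow> i \<le> 2 * Suc n \<Longrightarrow> e + of_nat i \<noteq> 0"
  shows "gap_weight e (Suc n) j = of_nat (n choose j) / pochhammer (e + 1 + of_nat j) (Suc n)
     + (if j = 0 then 0 else of_nat (n choose (j - 1)) / pochhammer (e + of_nat j) (Suc n))"
proof (cases j)
  case (Suc i)
  show ?thesis
  proof (cases "i \<le> n")
    case True
    have e2j: "e + 2 * of_nat j \<noteq> 0"
      using nz[of "2 * j"] True Suc by simp
    have ej: "e + of_nat j \<noteq> 0" "e + of_nat j + of_nat (Suc n) \<noteq> 0"
      using nz[of j] nz[of "j + Suc n"] True Suc by (simp_all add: add_ac)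
    define P where "P = pochhammer (e + of_nat j) (Suc (Suc n))"
    have P1: "P = (e + of_nat j) * pochhammer (e + 1 + of_nat j) (Suc n)"
      unfolding P_def by (subst pochhammer_rec) (simp add: add_ac)
    have P2: "P = (e + of_nat j + of_nat (Suc n)) * pochhammer (e + of_nat j) (Suc n)"
      unfolding P_def by (rule pochhammer_rec')
    have "Suc i * (n choose Suc i) = (n - i) * (n choose i)"
      by (metis binomial_absorb_comp binomial_absorption mult.commute)
    then have "of_nat (Suc i) * of_nat (n choose Suc i) = (of_nat (n - i) * of_nat (n choose i) :: 'a)"
      unfolding of_nat_mult[symmetric] by (simp only:)
    then have bin: "of_nat j * of_nat (n choose j) = (of_nat n + 1 - of_nat j) * (of_nat (n choose i) :: 'a)"
      using True Suc by (simp add: of_nat_diff)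
    have "gap_weight e (Suc n) j = of_nat (Suc n choose j) * (e + 2 * of_nat j) / P"
      unfolding P_def by (rule gap_weight_altdef[OF e2j])
    also have "of_nat (Suc n choose j) * (e + 2 * of_nat j) =
        of_nat (n choose j) * (e + of_nat j) + of_nat (n choose i) * (e + of_nat j + of_nat (Suc n))"
      using bin Suc by (simp add: algebra_simps)
    also have "\<dots> / P = of_nat (n choose j) * (e + of_nat j) / P
        + of_nat (n choose i) * (e + of_nat j + of_nat (Suc n)) / P"
      by (rule add_divide_distrib)
    also have "of_nat (n choose j) * (e + of_nat j) / P
        = of_nat (n choose j) / pochhammer (e + 1 + of_nat j) (Suc n)"
      unfolding P1 using ej by simp
    also have "of_nat (n choose i) * (e + of_nat j + of_nat (Suc n)) / P
        = of_nat (n choose i) / pochhammer (e + of_nat j) (Suc n)"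
      unfolding P2 using ej by (simp del: of_nat_Suc)
    finally show ?thesis using Suc by simp
  qed (simp add: gap_weight_def Suc binomial_eq_0)
qed (simp add: gap_weight_def)

text \<open>A weight of the form \<open>A j + A (j - 1)\<close> telescopes under alternating signs,
  leaving only the last \<open>A N\<close>.\<close>

lemma alternating_sum_gap_weight:
  fixes e :: "'a::field_char_0"
  assumes nz: "\<And>i. 1 \<le> i \<Longrightarrow> i \<le> 2 * Suc n \<Longrightarrow> e + of_nat i \<noteq> 0"
  shows "(\<Sum>j\<le>N. (-1) ^ j * gap_weight e (Suc n) j)
       = (-1) ^ N * of_nat (n choose N) / pochhammer (e + 1 + of_nat N) (Suc n)"
proof -
  have "gap_weight e (Suc n) j = of_nat (n choose j) / pochhammer (e + 1 + of_nat j) (Suc n)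
     + (if j = 0 then 0 else of_nat (n choose (j - 1)) / pochhammer (e + of_nat j) (Suc n))" for j
    by (rule gap_weight_Suc) (rule nz)
  then show ?thesis
    by (induction N) (simp_all add: algebra_simps)
qed

text \<open>Summation by parts: the sum of \<open>(A j + A (j - 1)) y j\<close> is the sum of
  \<open>A j (y j + y (j + 1))\<close>, and \<open>A j\<close> is
  \<open>gap_weight (e + 1) n j\<close> divided by \<open>e + 1 + 2 j\<close>. Hence the recursion
  closes once \<open>y j + y (j + 1)\<close> contains that factor.\<close>

lemma sum_gap_weight_Suc:
  fixes e :: "'a::field_char_0"
  assumes nz: "\<And>i. 1 \<le> i \<Longrightarrow> i \<le> 2 * Suc n \<Longrightarrow> e + of_nat i \<noteq> 0"
  assumes y: "\<And>j. j \<le> n \<Longrightarrow> y j + y (Suc j) = (e + 1 + 2 * of_nat j) * z j"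
  shows "(\<Sum>j\<le>Suc n. gap_weight e (Suc n) j * y j) = (\<Sum>j\<le>n. gap_weight (e + 1) n j * z j)"
proof -
  define A where "A j = of_nat (n choose j) / pochhammer (e + 1 + of_nat j) (Suc n)" for j
  have "(\<Sum>j\<le>Suc n. gap_weight e (Suc n) j * y j)
      = (\<Sum>j\<le>Suc n. A j * y j + (if j = 0 then 0 else A (j - 1) * y j))"
  proof (intro sum.cong refl)
    fix j
    have *: "gap_weight e (Suc n) j = of_nat (n choose j) / pochhammer (e + 1 + of_nat j) (Suc n)
     + (if j = 0 then 0 else of_nat (n choose (j - 1)) / pochhammer (e + of_nat j) (Suc n))"
      by (rule gap_weight_Suc) (rule nz)
    show "gap_weight e (Suc n) j * y j = A j * y j + (if j = 0 then 0 else A (j - 1) * y j)"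
      unfolding * A_def by (cases j) (simp_all add: algebra_simps)
  qed
  also have "\<dots> = (\<Sum>j\<le>Suc n. A j * y j) + (\<Sum>j\<le>Suc n. if j = 0 then 0 else A (j - 1) * y j)"
    by (rule sum.distrib)
  also have "(\<Sum>j\<le>Suc n. A j * y j) = (\<Sum>j\<le>n. A j * y j)"
    by (simp add: A_def)
  also have "(\<Sum>j\<le>Suc n. if j = 0 then 0 else A (j - 1) * y j) = (\<Sum>j\<le>n. A j * y (Suc j))"
    by (subst sum.atMost_Suc_shift) simp
  also have "(\<Sum>j\<le>n. A j * y j) + \<dots> = (\<Sum>j\<le>n. A j * (y j + y (Suc j)))"
    by (simp add: sum.distrib algebra_simps)
  also have "\<dots> = (\<Sum>j\<le>n. gap_weight (e + 1) n j * z j)"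
  proof (intro sum.cong refl)
    fix j assume j: "j \<in> {..n}"
    have "e + 1 + 2 * of_nat j \<noteq> 0"
      using nz[of "Suc (2 * j)"] j by (simp add: add_ac)
    then show "A j * (y j + y (Suc j)) = gap_weight (e + 1) n j * z j"
      using j by (simp add: y gap_weight_altdef A_def)
  qed
  finally show ?thesis .
qed

text \<open>Two neighbouring summands share \<open>(d)_j (e + 2 - d + j)_(n - j)\<close>, here with
  \<open>n + 1\<close> as the old length, and their cofactors add up to
  \<open>(e + 1 - d + j) + (d + j) = e + 1 + 2 j\<close>. So the sum is unchanged under
  \<open>(n + 1, e) -> (n, e + 1)\<close> with \<open>d\<close> fixed, down to the single term
  1.\<close>

lemma sum_gap_weight_pochhammer:
  fixes e d :: "'a::field_char_0"
  assumes nz: "\<And>i. 1 \<le> i \<Longrightarrow> i \<le> 2 * n \<Longrightarrow> e + of_nat i \<noteq> 0"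
  shows "(\<Sum>j\<le>n. gap_weight e n j * (pochhammer d j * pochhammer (e + 1 - d + of_nat j) (n - j))) = 1"
  using nz
proof (induction n arbitrary: e)
  case 0
  then show ?case by (simp add: gap_weight_def)
next
  case (Suc n)
  have "(\<Sum>j\<le>Suc n. gap_weight e (Suc n) j * (pochhammer d j * pochhammer (e + 1 - d + of_nat j) (Suc n - j)))
     = (\<Sum>j\<le>n. gap_weight (e + 1) n j * (pochhammer d j * pochhammer (e + 1 + 1 - d + of_nat j) (n - j)))"
  proof (rule sum_gap_weight_Suc)
    fix j assume "j \<le> n"
    then have *: "Suc n - j = Suc (n - j)" by simp
    have "pochhammer (e + 1 - d + of_nat j) (Suc n - j) =
       (e + 1 - d + of_nat j) * pochhammer (e + 1 + 1 - d + of_nat j) (n - j)"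
      unfolding * pochhammer_rec by (simp add: algebra_simps)
    moreover have "pochhammer (e + 1 - d + of_nat (Suc j)) (Suc n - Suc j)
        = pochhammer (e + 1 + 1 - d + of_nat j) (n - j)"
      by (simp add: algebra_simps)
    ultimately show "pochhammer d j * pochhammer (e + 1 - d + of_nat j) (Suc n - j) +
          pochhammer d (Suc j) * pochhammer (e + 1 - d + of_nat (Suc j)) (Suc n - Suc j) =
          (e + 1 + 2 * of_nat j) *
          (pochhammer d j * pochhammer (e + 1 + 1 - d + of_nat j) (n - j))"
      by (simp only: pochhammer_rec'[of d]) (simp only: algebra_simps mult_2)
  qed (use Suc.prems in auto)
  also have "\<dots> = 1"
  proof (rule Suc.IH)
    fix i assume "1 \<le> i" "i \<le> 2 * n"
    then show "e + 1 + of_nat i \<noteq> 0"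
      using Suc.prems[of "Suc i"] by (simp add: add_ac)
  qed
  finally show ?case .
qed

text \<open>Dougall's terminating very-well-poised \<open>\<^sub>5F\<^sub>4\<close>.\<close>
lemma sum_gap_weight_well_poised:
  fixes e b f :: "'a::field_char_0"
  assumes nz: "\<And>i. 1 \<le> i \<Longrightarrow> i \<le> 2 * n \<Longrightarrow> e + of_nat i \<noteq> 0"
  shows "(\<Sum>j\<le>n. gap_weight e n j * ((-1) ^ j *
           (pochhammer b j * pochhammer (e + 1 - b + of_nat j) (n - j)) *
           (pochhammer f j * pochhammer (e + 1 - f + of_nat j) (n - j))))
       = pochhammer (e + 1 - b - f) n"
  using nz
proof (induction n arbitrary: e)
  case 0
  then show ?case by (simp add: gap_weight_def)
next
  case (Suc n)
  have "(\<Sum>j\<le>Suc n. gap_weight e (Suc n) j * ((-1) ^ j *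
           (pochhammer b j * pochhammer (e + 1 - b + of_nat j) (Suc n - j)) *
           (pochhammer f j * pochhammer (e + 1 - f + of_nat j) (Suc n - j))))
     = (\<Sum>j\<le>n. gap_weight (e + 1) n j * ((e + 1 - b - f) * ((-1) ^ j *
           (pochhammer b j * pochhammer (e + 1 + 1 - b + of_nat j) (n - j)) *
           (pochhammer f j * pochhammer (e + 1 + 1 - f + of_nat j) (n - j)))))"
  proof (rule sum_gap_weight_Suc)
    fix j assume "j \<le> n"
    then have *: "Suc n - j = Suc (n - j)" by simp
    have 1: "pochhammer (e + 1 - d + of_nat j) (Suc n - j) =
       (e + 1 - d + of_nat j) * pochhammer (e + 1 + 1 - d + of_nat j) (n - j)" for d
      unfolding * pochhammer_rec by (simp add: algebra_simps)
    have 2: "pochhammer (e + 1 - d + of_nat (Suc j)) (Suc n - Suc j)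
        = pochhammer (e + 1 + 1 - d + of_nat j) (n - j)" for d
      by (simp add: algebra_simps)
    \<comment> \<open>The core is \<open>(e + 1 - b + J) (e + 1 - f + J) - (b + J) (f + J) = (e + 1
      + 2 J) (e + 1 - b - f)\<close>. The factor free of \<open>J\<close> leaves the sum, and
      iterating over \<open>e\<close> builds up the rising factorial of the result.\<close>
    have gen: "s * (B * ((e + 1 - b + J) * X)) * (F * ((e + 1 - f + J) * Y))
        + (- 1 * s) * (((b + J) * B) * X) * (((f + J) * F) * Y)
        = (e + 1 + 2 * J) * ((e + 1 - b - f) * (s * (B * X) * (F * Y)))" for s B X F Y J :: 'a
      by algebra
    show "(-1) ^ j *
           (pochhammer b j * pochhammer (e + 1 - b + of_nat j) (Suc n - j)) *
           (pochhammer f j * pochhammer (e + 1 - f + of_nat j) (Suc n - j)) +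
          (-1) ^ Suc j *
           (pochhammer b (Suc j) * pochhammer (e + 1 - b + of_nat (Suc j)) (Suc n - Suc j)) *
           (pochhammer f (Suc j) * pochhammer (e + 1 - f + of_nat (Suc j)) (Suc n - Suc j)) =
          (e + 1 + 2 * of_nat j) * ((e + 1 - b - f) * ((-1) ^ j *
           (pochhammer b j * pochhammer (e + 1 + 1 - b + of_nat j) (n - j)) *
           (pochhammer f j * pochhammer (e + 1 + 1 - f + of_nat j) (n - j))))"
      unfolding 1 2 pochhammer_rec'[of b] pochhammer_rec'[of f] power_Suc by (rule gen)
  qed (use Suc.prems in auto)
  also have "\<dots> = (e + 1 - b - f) * (\<Sum>j\<le>n. gap_weight (e + 1) n j * ((-1) ^ j *
           (pochhammer b j * pochhammer (e + 1 + 1 - b + of_nat j) (n - j)) *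
           (pochhammer f j * pochhammer (e + 1 + 1 - f + of_nat j) (n - j))))"
    unfolding sum_distrib_left by (intro sum.cong refl) (simp only: mult_ac)
  also have "(\<Sum>j\<le>n. gap_weight (e + 1) n j * ((-1) ^ j *
           (pochhammer b j * pochhammer (e + 1 + 1 - b + of_nat j) (n - j)) *
           (pochhammer f j * pochhammer (e + 1 + 1 - f + of_nat j) (n - j))))
        = pochhammer (e + 1 + 1 - b - f) n"
  proof (rule Suc.IH)
    fix i assume "1 \<le> i" "i \<le> 2 * n"
    then show "e + 1 + of_nat i \<noteq> 0"
      using Suc.prems[of "Suc i"] by (simp add: add_ac)
  qed
  also have "(e + 1 - b - f) * pochhammer (e + 1 + 1 - b - f) n = pochhammer (e + 1 - b - f) (Suc n)"
    by (simp add: pochhammer_rec algebra_simps)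
  finally show ?case .
qed

text \<open>Reflecting all rising factorials with \<open>e = b + f - c - n\<close> turns the
  coefficients into \<open>gap_weight e n j\<close> up to sign. The first sum then becomes the
  well-poised one with value \<open>(1 - c - n)_n = (-1)^n (c)_n\<close>, the second the one with
  value 1.\<close>

lemma sum_well_poised:
  fixes c b f :: "'a::field_char_0"
  assumes nz: "\<And>j. j \<le> n \<Longrightarrow> pochhammer (c - b - f - of_nat j) (n + 1) \<noteq> 0"
  shows "pochhammer c n =
          (\<Sum>j=0..n. (-1) ^ j * of_nat (n choose j) *
             (pochhammer b j * pochhammer f j * pochhammer (c - b) (n - j)
                * pochhammer (c - f) (n - j) * (c - b - f + of_nat n - 2 * of_nat j)
              / pochhammer (c - b - f - of_nat j) (n + 1)))" (is ?A)
    and "1 = (\<Sum>j=0..n. (-1) ^ j * of_nat (n choose j) *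
             (pochhammer b j * pochhammer (c - f) (n - j)
                * (c - b - f + of_nat n - 2 * of_nat j)
              / pochhammer (c - b - f - of_nat j) (n + 1)))" (is ?B)
proof -
  define e where "e = b + f - c - of_nat n"
  have nz': "e + of_nat i \<noteq> 0" if "i \<le> 2 * n" for i
  proof
    assume *: "e + of_nat i = 0"
    \<comment> \<open>Truncated subtraction selects a vanishing denominator:
      \<open>c - b - f = i - n\<close> is a zero of the one with index 0 if \<open>i <= n\<close>,
      and of the one with index \<open>i - n\<close> otherwise.\<close>
    have "pochhammer (c - b - f - of_nat (i - n)) (n + 1) = 0"
      unfolding pochhammer_eq_0_iff
    proof (intro exI conjI)
      have "c - b - f = of_nat i - of_nat n"
        using * by (simp add: e_def algebra_simps)
      then show "c - b - f - of_nat (i - n) = - of_nat (n - (i - (i - n)))"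
        using that by (cases "i \<le> n") (simp_all add: of_nat_diff)
    qed simp
    with nz[of "i - n"] that show False by simp
  qed
  have gw: "of_nat (n choose j) * (c - b - f + of_nat n - 2 * of_nat j)
      / pochhammer (c - b - f - of_nat j) (n + 1) = (-1) ^ n * gap_weight e n j" if "j \<le> n" for j
  proof -
    have P: "pochhammer (c - b - f - of_nat j) (n + 1) = (-1) ^ (n + 1) * pochhammer (e + of_nat j) (n + 1)"
      using pochhammer_minus[of "b + f - c + of_nat j" "n + 1"] by (simp add: e_def algebra_simps)
    have W: "gap_weight e n j = of_nat (n choose j) * (e + 2 * of_nat j) / pochhammer (e + of_nat j) (n + 1)"
      using gap_weight_altdef[of e j n] nz'[of "2 * j"] that by simp
    have L: "c - b - f + of_nat n - 2 * of_nat j = - (e + 2 * of_nat j)"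
      by (simp add: e_def)
    have "N * (- X) / ((-1) ^ (n + 1) * Q) = (-1) ^ n * (N * X / Q)" for N X Q :: 'a
      by (cases "even n") simp_all
    then show ?thesis
      unfolding P W L .
  qed
  \<comment> \<open>Reflection exchanges \<open>b\<close> and \<open>f\<close>: at
    \<open>x = f\<close> the base is \<open>e + 1 - b + j\<close>, at \<open>x = b\<close> it is
    \<open>e + 1 - f + j\<close>.\<close>
  have reflect: "pochhammer (c - x) (n - j) = (-1) ^ (n + j) * pochhammer (e + 1 - (b + f - x) + of_nat j) (n - j)"
    if "j \<le> n" for j x
  proof -
    have "(-1 :: 'a) ^ (n - j) = (-1) ^ (n + j)"
      using that by (simp add: minus_one_power_iff)
    then show ?thesis
      using pochhammer_minus[of "x - c" "n - j"] that by (simp add: e_def of_nat_diff algebra_simps)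
  qed
  have sgn: "(-1 :: 'a) ^ k * (-1) ^ k = 1" for k
    by (simp flip: power_mult_distrib)
  show ?B
  proof -
    have "(\<Sum>j=0..n. (-1) ^ j * of_nat (n choose j) *
             (pochhammer b j * pochhammer (c - f) (n - j)
                * (c - b - f + of_nat n - 2 * of_nat j)
              / pochhammer (c - b - f - of_nat j) (n + 1)))
       = (\<Sum>j\<le>n. gap_weight e n j * (pochhammer b j * pochhammer (e + 1 - b + of_nat j) (n - j)))"
      unfolding atMost_atLeast0
    proof (intro sum.cong refl)
      fix j assume "j \<in> {0..n}"
      then have j: "j \<le> n" by simp
      have "(-1) ^ j * of_nat (n choose j) *
             (pochhammer b j * pochhammer (c - f) (n - j)
                * (c - b - f + of_nat n - 2 * of_nat j)
              / pochhammer (c - b - f - of_nat j) (n + 1))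
         = (-1) ^ j * pochhammer b j * pochhammer (c - f) (n - j) *
            (of_nat (n choose j) * (c - b - f + of_nat n - 2 * of_nat j)
              / pochhammer (c - b - f - of_nat j) (n + 1))"
        by (simp only: times_divide_eq_right mult_ac)
      also have "\<dots> = ((-1) ^ j * (-1) ^ j) * ((-1) ^ n * (-1) ^ n) *
         (gap_weight e n j * (pochhammer b j * pochhammer (e + 1 - b + of_nat j) (n - j)))"
        unfolding gw[OF j] reflect[OF j] power_add by (simp only: mult_ac add_diff_cancel_right')
      finally show "(-1) ^ j * of_nat (n choose j) *
             (pochhammer b j * pochhammer (c - f) (n - j)
                * (c - b - f + of_nat n - 2 * of_nat j)
              / pochhammer (c - b - f - of_nat j) (n + 1)) =
         gap_weight e n j * (pochhammer b j * pochhammer (e + 1 - b + of_nat j) (n - j))"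
        by (simp add: sgn)
    qed
    also have "\<dots> = 1"
      by (rule sum_gap_weight_pochhammer) (use nz' in auto)
    finally show ?thesis ..
  qed
  show ?A
  proof -
    have "(\<Sum>j=0..n. (-1) ^ j * of_nat (n choose j) *
             (pochhammer b j * pochhammer f j * pochhammer (c - b) (n - j)
                * pochhammer (c - f) (n - j) * (c - b - f + of_nat n - 2 * of_nat j)
              / pochhammer (c - b - f - of_nat j) (n + 1)))
       = (\<Sum>j\<le>n. (-1) ^ n * (gap_weight e n j * ((-1) ^ j *
           (pochhammer b j * pochhammer (e + 1 - b + of_nat j) (n - j)) *
           (pochhammer f j * pochhammer (e + 1 - f + of_nat j) (n - j)))))"
      unfolding atMost_atLeast0
    proof (intro sum.cong refl)
      fix j assume "j \<in> {0..n}"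
      then have j: "j \<le> n" by simp
      have "(-1) ^ j * of_nat (n choose j) *
             (pochhammer b j * pochhammer f j * pochhammer (c - b) (n - j)
                * pochhammer (c - f) (n - j) * (c - b - f + of_nat n - 2 * of_nat j)
              / pochhammer (c - b - f - of_nat j) (n + 1))
         = (-1) ^ j * pochhammer b j * pochhammer f j * pochhammer (c - b) (n - j) * pochhammer (c - f) (n - j) *
            (of_nat (n choose j) * (c - b - f + of_nat n - 2 * of_nat j)
              / pochhammer (c - b - f - of_nat j) (n + 1))"
        by (simp only: times_divide_eq_right mult_ac)
      also have "\<dots> = ((-1) ^ (n + j) * (-1) ^ (n + j)) * ((-1) ^ n *
         (gap_weight e n j * ((-1) ^ j *
           (pochhammer b j * pochhammer (e + 1 - b + of_nat j) (n - j)) *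
           (pochhammer f j * pochhammer (e + 1 - f + of_nat j) (n - j)))))"
        unfolding gw[OF j] reflect[OF j] by (simp only: mult_ac add_diff_cancel_right' add_diff_cancel_left')
      finally show "(-1) ^ j * of_nat (n choose j) *
             (pochhammer b j * pochhammer f j * pochhammer (c - b) (n - j)
                * pochhammer (c - f) (n - j) * (c - b - f + of_nat n - 2 * of_nat j)
              / pochhammer (c - b - f - of_nat j) (n + 1)) =
         (-1) ^ n * (gap_weight e n j * ((-1) ^ j *
           (pochhammer b j * pochhammer (e + 1 - b + of_nat j) (n - j)) *
           (pochhammer f j * pochhammer (e + 1 - f + of_nat j) (n - j))))"
        by (simp add: sgn)
    qed
    also have "\<dots> = (-1) ^ n * pochhammer (e + 1 - b - f) n"
      unfolding sum_distrib_left[symmetric]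
      by (subst sum_gap_weight_well_poised) (use nz' in auto)
    also have "\<dots> = pochhammer c n"
      using pochhammer_minus[of "- c" n] by (simp add: e_def algebra_simps)
    finally show ?thesis ..
  qed
qed

subsection \<open>Interchange of summation\<close>

lemma of_real_in_nonpos_IntsE:
  assumes "complex_of_real x \<in> \<int>\<^sub>\<le>\<^sub>0"
  obtains n where "x = - real n"
proof -
  from assms obtain n where "complex_of_real x = - of_nat n" by (auto elim: nonpos_Ints_cases')
  then have "x = - real n" by (metis of_real_eq_iff of_real_minus of_real_of_nat_eq)
  then show ?thesis by (rule that)
qed

text \<open>The weight with which the \<open>k\<close>-th coefficient of the original series enters
  the \<open>j\<close>-th inner series; \<open>coefficient_times_hypergeom\<close> makes this
  precise.\<close>

definition beta_weight :: "real \<Rightarrow> real \<Rightarrow> nat \<Rightarrow> nat \<Rightarrow> real" where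
  "beta_weight d f k j = gap_weight (d + f - 1) k j * pochhammer (f + real j) (k - j)"

section \<open>Positivity, bounds and partial sums of the weights\<close>

context
  fixes d f :: real
  assumes d: "d > 0" and f: "f > 0"
begin

lemma e_nonzero: "i \<ge> 1 \<Longrightarrow> d + f - 1 + real i \<noteq> 0"
  using d f by (simp add: of_nat_diff)

lemma beta_weight_nonneg: "beta_weight d f k j \<ge> 0"
proof -
  have "pochhammer (d + f - 1 + real j) j \<ge> 0"
  \<comment> \<open>At \<open>j = 0\<close> the base \<open>d + f - 1\<close> may be negative, but
    the product is empty; for \<open>j > 0\<close> the base is positive.\<close>
  proof (cases j)
    case (Suc i)
    then show ?thesis using d f by (intro pochhammer_nonneg) auto
  qed simp
  moreover have "pochhammer (d + f - 1 + 2 * real j + 1) (k - j) \<ge> 0"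
    using d f by (intro pochhammer_nonneg) auto
  moreover have "pochhammer (f + real j) (k - j) \<ge> 0"
    using f by (intro pochhammer_nonneg) auto
  ultimately show ?thesis by (simp add: beta_weight_def gap_weight_def)
qed

lemma beta_weight_eq_0: "j > k \<Longrightarrow> beta_weight d f k j = 0"
  by (simp add: beta_weight_def gap_weight_def binomial_eq_0)

lemma sum_beta_weight: "(\<Sum>j\<le>k. pochhammer d j * beta_weight d f k j) = 1"
proof -
  have "(\<Sum>j\<le>k. gap_weight (d + f - 1) k j *
     (pochhammer d j * pochhammer (d + f - 1 + 1 - d + of_nat j) (k - j))) = 1"
    by (rule sum_gap_weight_pochhammer) (rule e_nonzero)
  then show ?thesis by (simp add: beta_weight_def mult_ac)
qed

lemma sum_beta_weight_lessThan:
  assumes "k < N"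
  shows "(\<Sum>j<N. pochhammer d j * beta_weight d f k j) = 1"
proof -
  have "(\<Sum>j<N. pochhammer d j * beta_weight d f k j) = (\<Sum>j\<le>k. pochhammer d j * beta_weight d f k j)"
    using assms by (intro sum.mono_neutral_right) (auto simp: beta_weight_eq_0)
  then show ?thesis by (simp add: sum_beta_weight)
qed

lemma partial_sum_beta_weight_le_1: "(\<Sum>j<N. pochhammer d j * beta_weight d f k j) \<le> 1"
proof -
  have "(\<Sum>j<N. pochhammer d j * beta_weight d f k j) \<le>
        (\<Sum>j<max N (Suc k). pochhammer d j * beta_weight d f k j)"
    using d by (intro sum_mono2) (auto intro!: mult_nonneg_nonneg beta_weight_nonneg pochhammer_nonneg)
  also have "\<dots> = 1" by (intro sum_beta_weight_lessThan) auto
  finally show ?thesis .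
qed

lemma beta_weight_le: "beta_weight d f k j \<le> 1 / pochhammer d j"
proof -
  have "pochhammer d j * beta_weight d f k j \<le> (\<Sum>j<Suc j. pochhammer d j * beta_weight d f k j)"
    using d by (intro member_le_sum) (auto intro!: mult_nonneg_nonneg beta_weight_nonneg pochhammer_nonneg)
  also have "\<dots> \<le> 1" by (rule partial_sum_beta_weight_le_1)
  finally show ?thesis using pochhammer_pos[OF d, of j] by (simp add: field_simps)
qed

text \<open>The factor \<open>p\<close> is left open to serve both \<open>(d)_j\<close> and
  \<open>(-1)^j (f)_j\<close>.\<close>

lemma summable_norm_beta_weight:
  fixes u :: "nat \<Rightarrow> complex"
  assumes "summable (\<lambda>k. norm (u k))"
  shows "summable (\<lambda>k. norm (u k * of_real (p * beta_weight d f k j)))"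
proof (rule summable_comparison_test')
  show "summable (\<lambda>k. norm (u k) * (\<bar>p\<bar> / pochhammer d j))"
    using assms by (rule summable_mult2)
  show "norm (norm (u k * of_real (p * beta_weight d f k j))) \<le> norm (u k) * (\<bar>p\<bar> / pochhammer d j)" for k
  proof -
    have "\<bar>p\<bar> * beta_weight d f k j \<le> \<bar>p\<bar> * (1 / pochhammer d j)"
      by (intro mult_left_mono beta_weight_le) auto
    then have "norm (u k) * (\<bar>p\<bar> * beta_weight d f k j) \<le> norm (u k) * (\<bar>p\<bar> * (1 / pochhammer d j))"
      by (rule mult_left_mono) auto
    then show ?thesis
      using beta_weight_nonneg[of k j] by (simp add: norm_mult abs_mult)
  qed
qed

text \<open>\<open>(f)_j (f + j)_(k - j) = (f)_k\<close> does not depend on \<open>j\<close>, so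
  only the telescoping sum of gap weights is left. For \<open>k > 0\<close> it vanishes once
  \<open>M >= k\<close>: in the limit only \<open>k = 0\<close> survives, which is why the first
  series of (i) has the value 1.\<close>

lemma alternating_sum_beta_weight:
  "(\<Sum>j\<le>M. (-1) ^ j * pochhammer f j * beta_weight d f k j) =
     (if k = 0 then 1
      else (-1) ^ M * pochhammer f k * real ((k - 1) choose M) / pochhammer (d + f + real M) k)"
proof -
  have "(\<Sum>j\<le>M. (-1) ^ j * pochhammer f j * beta_weight d f k j) =
      (\<Sum>j\<le>M. pochhammer f k * ((-1) ^ j * gap_weight (d + f - 1) k j))"
  proof (intro sum.cong refl)
    fix j
    show "(-1) ^ j * pochhammer f j * beta_weight d f k j = pochhammer f k * ((-1) ^ j * gap_weight (d + f - 1) k j)"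
      by (cases "j \<le> k")
         (simp_all add: beta_weight_def pochhammer_product[of j k f] gap_weight_def binomial_eq_0)
  qed
  also have "\<dots> = pochhammer f k * (\<Sum>j\<le>M. (-1) ^ j * gap_weight (d + f - 1) k j)"
    by (simp add: sum_distrib_left)
  also have "\<dots> = (if k = 0 then 1
      else (-1) ^ M * pochhammer f k * real ((k - 1) choose M) / pochhammer (d + f + real M) k)"
  proof (cases k)
    case 0
    have "(\<Sum>j\<le>M. (-1) ^ j * gap_weight (d + f - 1) 0 j) = (\<Sum>j\<le>M. if j = 0 then 1 else (0 :: real))"
      by (intro sum.cong refl) (auto simp: gap_weight_def binomial_eq_0)
    then show ?thesis using 0 by simp
  next
    case (Suc n)
    have "(\<Sum>j\<le>M. (-1) ^ j * gap_weight (d + f - 1) (Suc n) j)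
        = (-1) ^ M * of_nat (n choose M) / pochhammer (d + f - 1 + 1 + of_nat M) (Suc n)"
      by (rule alternating_sum_gap_weight) (rule e_nonzero)
    then show ?thesis using Suc by simp
  qed
  finally show ?thesis .
qed

end

text \<open>Since \<open>(M + i choose M) = (N)_i / i!\<close> and
  \<open>(e + N)_(N + i) = (e + N)_N (e + 2 N)_i\<close>, this is a Gauss series with parameters
  \<open>p + N\<close>, \<open>N\<close> and \<open>e + 2 N\<close>. The excess \<open>e - p\<close>
  does not depend on \<open>N\<close>, and the Gamma quotient collapses.\<close>

lemma sums_beta_remainder:
  assumes N: "N = Suc M" and e: "e + real N > 0" and ep: "e - p > 0"
  shows "(\<lambda>i. pochhammer (p + real N) i * real ((M + i) choose M) / pochhammer (e + real N) (N + i))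
     sums (1 / pochhammer (e - p) N)"
proof -
  define t where "t = (\<lambda>i. pochhammer (p + real N) i * real ((M + i) choose M) / pochhammer (e + real N) (N + i))"
  define a b c where "a = complex_of_real (p + real N)" and "b = complex_of_real (real N)"
    and "c = complex_of_real (e + 2 * real N)"
  define Q where "Q = pochhammer (e + real N) N"
  have Q: "Q > 0" unfolding Q_def using e by (intro pochhammer_pos)
  have bin: "real ((M + i) choose M) = pochhammer (real N) i / fact i" for i
  proof -
    have "pochhammer (1 :: real) (M + i) = pochhammer 1 M * pochhammer (1 + real M) i"
      by (rule pochhammer_product')
    then have "fact (M + i) = fact M * pochhammer (real N) i"
      using N by (simp add: pochhammer_fact[symmetric] add_ac)
    then show ?thesis by (simp add: binomial_fact)
  qed
  have t: "complex_of_real (t i) = gauss_term a b c i * (1 / of_real Q)" for i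
  proof -
    have "t i = pochhammer (p + real N) i * pochhammer (real N) i / (pochhammer (e + 2 * real N) i * fact i) * (1 / Q)"
      unfolding t_def bin pochhammer_product' Q_def by (simp add: mult_2 add.assoc mult_ac)
    then show ?thesis
      unfolding a_def b_def c_def gauss_term_def pochhammer_of_real by simp
  qed
  have c: "Re c > 0" and s: "Re (c - a - b) > 0"
    using e ep N by (auto simp: a_def b_def c_def)
  have "gauss_term a b c sums (Gamma c * Gamma (c - a - b) * rGamma (c - a) * rGamma (c - b))"
    using summable_sums[OF summable_norm_cancel[OF summable_norm_gauss_term[OF c s]]]
    by (simp add: gauss_summation[OF c s])
  then have "(\<lambda>i. complex_of_real (t i)) sums
     (Gamma c * Gamma (c - a - b) * rGamma (c - a) * rGamma (c - b) * (1 / of_real Q))"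
    unfolding t by (rule sums_mult2)
  also have "Gamma c * Gamma (c - a - b) * rGamma (c - a) * rGamma (c - b) * (1 / of_real Q)
      = of_real (1 / pochhammer (e - p) N)"
  proof -
    have "c - a - b = of_real (e - p)" "c - a = of_real (e - p + real N)" "c - b = of_real (e + real N)"
      "c = of_real (e + real N + real N)"
      by (simp_all add: a_def b_def c_def)
    then have G: "Gamma (c - a - b) = of_real (Gamma (e - p))"
      "rGamma (c - a) = of_real (inverse (Gamma (e - p + real N)))"
      "rGamma (c - b) = of_real (inverse (Gamma (e + real N)))"
      "Gamma c = of_real (Gamma (e + real N + real N))"
      by (simp_all only: rGamma_inverse_Gamma Gamma_complex_of_real of_real_inverse)
    have "e - p \<notin> \<int>\<^sub>\<le>\<^sub>0" "e + real N \<notin> \<int>\<^sub>\<le>\<^sub>0"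
      using e ep by (auto elim!: nonpos_Ints_cases)
    then have PG: "pochhammer (e - p) N = Gamma (e - p + real N) / Gamma (e - p)"
      "Q = Gamma (e + real N + real N) / Gamma (e + real N)"
      unfolding Q_def using pochhammer_Gamma by blast+
    have "Gamma (e - p + real N) > 0" "Gamma (e + real N) > 0" "Gamma (e - p) > 0"
       "Gamma (e + real N + real N) > 0"
      using e ep by (auto intro!: Gamma_real_pos)
    then have "Gamma (e + real N + real N) * Gamma (e - p) * inverse (Gamma (e - p + real N)) *
       inverse (Gamma (e + real N)) * (1 / Q) = 1 / pochhammer (e - p) N"
      unfolding PG by (simp add: field_simps)
    from arg_cong[OF this, of complex_of_real] show ?thesis
      unfolding G by simp
  qed
  finally show ?thesis
    unfolding t_def[symmetric] sums_of_real_iff .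
qed

text \<open>With \<open>p = f - r - 1\<close> for some \<open>r < s\<close>,
  \<open>norm (u k) (f)_k\<close> is at most a multiple of \<open>|(p)_k|\<close>. The summands with
  \<open>n < M\<close> vanish, and after pulling out \<open>|(p)_N|\<close>,
  \<open>N = M + 1\<close>, the rest is bounded by the series of \<open>sums_beta_remainder\<close>.
  The resulting bound \<open>|(p)_N| / (e - p)_N\<close> is \<open>O(N^(2 p - e))\<close>.\<close>

lemma beta_remainder_tendsto_0:
  fixes u :: "nat \<Rightarrow> complex"
  assumes d: "d > 0" and f: "f > 0" and s: "s > 0" "f < d + 1 + 2 * s"
    and u: "(\<lambda>k. norm (u k)) \<in> O(\<lambda>k. real k powr (- s - 1))"
  shows "(\<lambda>M. \<Sum>n. norm (u (Suc n)) * (pochhammer f (Suc n) * real (n choose M) /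
            pochhammer (d + f + real M) (Suc n))) \<longlonglongrightarrow> 0" (is ?lim)
    and "\<forall>\<^sub>F M in sequentially. summable (\<lambda>n. norm (u (Suc n)) * (pochhammer f (Suc n) * real (n choose M) /
            pochhammer (d + f + real M) (Suc n)))" (is ?sum)
proof -
  \<comment> \<open>With \<open>e = d + f - 1\<close>, the inequality \<open>2 p < e\<close> means
    \<open>r > (f - d - 1) / 2\<close>, and \<open>r > 0\<close> ensures
    \<open>e - p = d + r > 0\<close>. The hypotheses on \<open>s\<close> say
    \<open>l < s\<close>.\<close>
  define l where "l = max 0 ((f - d - 1) / 2)"
  \<comment> \<open>Lowering \<open>s\<close> slightly to \<open>r\<close> keeps \<open>p = f - r - 1\<close> off the zeros of the rising factorials.\<close>
  have "uncountable {l<..<s}"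
    using s by (simp add: uncountable_open_interval l_def)
  moreover have "countable (range (\<lambda>n::nat. f - 1 + real n))"
    by simp
  ultimately obtain r where r: "r \<in> {l<..<s}" "r \<notin> range (\<lambda>n::nat. f - 1 + real n)"
    by (meson countable_subset subsetI)
  define p where "p = f - r - 1"
  define e where "e = d + f - 1"
  have p': "complex_of_real p \<notin> \<int>\<^sub>\<le>\<^sub>0"
  proof
    assume "complex_of_real p \<in> \<int>\<^sub>\<le>\<^sub>0"
    then obtain n where "p = - real n" by (rule of_real_in_nonpos_IntsE)
    then have "r = f - 1 + real n" by (simp add: p_def)
    with r(2) show False by blast
  qed
  have ep: "e - p > 0" and pe: "2 * p - e < 0"
    using r d by (auto simp: e_def p_def l_def)
  have nrm: "norm (pochhammer (complex_of_real x) n) = \<bar>pochhammer x n\<bar>" for x n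
    by (simp add: pochhammer_of_real)
  have "(\<lambda>k. norm (u k) * norm (pochhammer (complex_of_real f) k))
     \<in> O(\<lambda>k. real k powr (- s - 1) * (fact (k - 1) * real k powr Re (complex_of_real f)))"
    by (intro landau_o.big.mult u norm_pochhammer_bigo)
  also have "(\<lambda>k. real k powr (- s - 1) * (fact (k - 1) * real k powr Re (complex_of_real f)))
     \<in> O(\<lambda>k. fact (k - 1) * real k powr Re (complex_of_real p))"
  proof (rule bigoI[of _ 1], rule eventually_mono[OF eventually_gt_at_top[of 0]])
    fix k :: nat assume k: "k > 0"
    have "real k powr (- s - 1 + f) \<le> real k powr p"
      using k r by (intro powr_mono) (auto simp: p_def)
    then show "norm (real k powr (- s - 1) * (fact (k - 1) * real k powr Re (complex_of_real f)))
        \<le> 1 * norm (fact (k - 1) * real k powr Re (complex_of_real p))"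
      by (simp add: powr_add mult_ac)
  qed
  also have "(\<lambda>k. fact (k - 1) * real k powr Re (complex_of_real p))
      \<in> O(\<lambda>k. norm (pochhammer (complex_of_real p) k))"
    by (rule pochhammer_in_bigomega[OF p'])
  finally obtain C where C: "C > 0"
    "\<forall>\<^sub>F k in sequentially. norm (u k) * \<bar>pochhammer f k\<bar> \<le> C * \<bar>pochhammer p k\<bar>"
    unfolding nrm by (elim landau_o.bigE) auto
  then obtain K where K: "\<And>k. k \<ge> K \<Longrightarrow> norm (u k) * \<bar>pochhammer f k\<bar> \<le> C * \<bar>pochhammer p k\<bar>"
    unfolding eventually_sequentially by blast
  \<comment> \<open>From \<open>L\<close> on the bound by \<open>(p)_k\<close> is valid and
    \<open>p + N > 0\<close>, so only the factor \<open>(p)_N\<close> of \<open>(p)_(N + i)\<close>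
    needs an absolute value.\<close>
  define L where "L = max K (nat \<lceil>\<bar>p\<bar>\<rceil> + 1)"
  define F where "F M n = norm (u (Suc n)) * (pochhammer f (Suc n) * real (n choose M) /
            pochhammer (d + f + real M) (Suc n))" for M n
  define B where "B N = C * (\<bar>pochhammer p N\<bar> / pochhammer (e - p) N)" for N
  have main: "summable (F M) \<and> suminf (F M) \<le> B (Suc M)" if M: "M \<ge> L" for M
  proof -
    define N where "N = Suc M"
    have eN: "e + real N > 0" using d f by (simp add: e_def N_def)
    have pN: "p + real N > 0" using M by (simp add: N_def L_def) linarith
    have "(\<lambda>i. C * \<bar>pochhammer p N\<bar> *
        (pochhammer (p + real N) i * real ((M + i) choose M) / pochhammer (e + real N) (N + i)))
       sums (C * \<bar>pochhammer p N\<bar> * (1 / pochhammer (e - p) N))"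
      by (intro sums_mult sums_beta_remainder[OF N_def eN ep])
    \<comment> \<open>The binomial coefficient makes \<open>F M n\<close> vanish for
      \<open>n < M\<close>; position \<open>n = i + M\<close> belongs to the coefficient
      \<open>u (N + i)\<close>.\<close>
    moreover have Fle: "F M (i + M) \<le> C * \<bar>pochhammer p N\<bar> *
        (pochhammer (p + real N) i * real ((M + i) choose M) / pochhammer (e + real N) (N + i))" for i
    proof -
      have "F M (i + M) = norm (u (N + i)) * \<bar>pochhammer f (N + i)\<bar> *
          (real ((M + i) choose M) / pochhammer (e + real N) (N + i))"
        using pochhammer_pos[OF f, of "N + i"]
        by (simp add: F_def N_def e_def add_ac)
      also have "\<dots> \<le> C * \<bar>pochhammer p (N + i)\<bar> *
          (real ((M + i) choose M) / pochhammer (e + real N) (N + i))"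
        using M pochhammer_pos[OF eN, of "N + i"]
        by (intro mult_right_mono K) (auto simp: N_def L_def)
      also have "\<bar>pochhammer p (N + i)\<bar> = \<bar>pochhammer p N\<bar> * pochhammer (p + real N) i"
        using pochhammer_pos[OF pN, of i] by (simp add: pochhammer_product' abs_mult)
      finally show ?thesis by (simp add: mult_ac)
    qed
    moreover have F0: "F M k \<ge> 0" for k
      using d f by (auto simp: F_def intro!: mult_nonneg_nonneg divide_nonneg_nonneg pochhammer_nonneg)
    ultimately have sm: "summable (\<lambda>i. F M (i + M))"
      by (intro summable_comparison_test'[OF sums_summable]) auto
    then have "summable (F M)" by simp
    moreover have "suminf (F M) = (\<Sum>i. F M (i + M))"
    proof -
      have "(\<lambda>i. F M (i + M)) sums (\<Sum>i. F M (i + M))" using sm by (rule summable_sums)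
      then have "F M sums (\<Sum>i. F M (i + M))"
        by (subst (asm) sums_zero_iff_shift) (auto simp: F_def)
      then show ?thesis by (simp add: sums_iff)
    qed
    moreover have "(\<Sum>i. F M (i + M)) \<le> C * \<bar>pochhammer p N\<bar> * (1 / pochhammer (e - p) N)"
      using sums_le[OF Fle summable_sums[OF sm]]
        sums_mult[OF sums_beta_remainder[OF N_def eN ep], of "C * \<bar>pochhammer p N\<bar>"] by blast
    ultimately show ?thesis by (simp add: B_def N_def)
  qed
  have "B \<in> O(\<lambda>N. real N powr (2 * p - e))"
  proof -
    have ep': "complex_of_real (e - p) \<notin> \<int>\<^sub>\<le>\<^sub>0"
      by (rule Re_pos_notin_nonpos_Ints) (use ep in simp)
    have nz: "pochhammer (e - p) n \<noteq> 0" for n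
      using pochhammer_pos[OF ep, of n] by simp
    have "(\<lambda>N. norm (pochhammer (complex_of_real p) N) / norm (pochhammer (complex_of_real (e - p)) N))
        \<in> O(\<lambda>N. (fact (N - 1) * real N powr Re (of_real p)) / (fact (N - 1) * real N powr Re (of_real (e - p))))"
      by (intro landau_o.big.divide norm_pochhammer_bigo pochhammer_in_bigomega ep')
         (auto simp: nz pochhammer_of_real intro!: eventually_mono[OF eventually_gt_at_top[of 0]]
               simp del: of_real_diff)
    also have "(\<lambda>N. (fact (N - 1) * real N powr Re (of_real p)) / (fact (N - 1) * real N powr Re (of_real (e - p))))
       = (\<lambda>N. real N powr (2 * p - e))"
      by (rule ext) (simp add: powr_diff[symmetric])
    finally have *: "(\<lambda>N. \<bar>pochhammer p N\<bar> / \<bar>pochhammer (e - p) N\<bar>) \<in> O(\<lambda>N. real N powr (2 * p - e))"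
      unfolding nrm .
    have "B = (\<lambda>N. C * (\<bar>pochhammer p N\<bar> / \<bar>pochhammer (e - p) N\<bar>))"
      using pochhammer_pos[OF ep] by (simp add: B_def fun_eq_iff less_imp_le)
    then show ?thesis using * C(1) by (simp only: landau_o.big.cmult_in_iff)
  qed
  moreover have "(\<lambda>N. real N powr (2 * p - e)) \<longlonglongrightarrow> 0"
    using pe by real_asymp
  ultimately have "B \<longlonglongrightarrow> 0" by (rule bigo_tendsto_0)
  then have B: "(\<lambda>M. B (Suc M)) \<longlonglongrightarrow> 0" by (rule LIMSEQ_Suc)
  have F0: "F M k \<ge> 0" for M k
    using d f by (auto simp: F_def intro!: mult_nonneg_nonneg divide_nonneg_nonneg pochhammer_nonneg)
  have "(\<lambda>M. suminf (F M)) \<longlonglongrightarrow> 0"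
  proof (rule tendsto_sandwich[OF _ _ tendsto_const B])
    show "\<forall>\<^sub>F M in sequentially. 0 \<le> suminf (F M)"
      using eventually_ge_at_top[of L] by eventually_elim (use main F0 in \<open>auto intro!: suminf_nonneg\<close>)
    show "\<forall>\<^sub>F M in sequentially. suminf (F M) \<le> B (Suc M)"
      using eventually_ge_at_top[of L] by eventually_elim (use main in auto)
  qed
  then show ?lim unfolding F_def .
  have "\<forall>\<^sub>F M in sequentially. summable (F M)"
    using eventually_ge_at_top[of L] by eventually_elim (use main in auto)
  then show ?sum unfolding F_def .
qed

section \<open>From the inner series to the two identities of (i)\<close>

lemma prod_pochhammer_shift:
  "(\<Prod>a\<leftarrow>as. pochhammer (a::complex) (j + i)) =
   (\<Prod>a\<leftarrow>as. pochhammer a j) * (\<Prod>a\<leftarrow>as. pochhammer (a + of_nat j) i)"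
  by (induction as) (simp_all add: pochhammer_product' mult_ac)

text \<open>By \<open>(a)_(j + i) = (a)_j (a + j)_i\<close> the prefactor times the
  \<open>i\<close>-th inner term is the term \<open>k = i + j\<close> on the right. The terms with
  \<open>k < j\<close> vanish, since \<open>beta_weight\<close> is 0 there.\<close>

lemma coefficient_times_hypergeom:
  fixes d f p :: real
  assumes d: "d > 0" and f: "f > 0"
  assumes sm: "summable (\<lambda>k. norm (hypergeom_coeff as bs k))"
  shows "of_real p / fact j *
      ((\<Prod>a\<leftarrow>as. pochhammer a j)
        / ((\<Prod>b\<leftarrow>bs. pochhammer b j) * pochhammer (of_real (d + f + real j - 1)) j))
      * hypergeom (map (\<lambda>a. a + of_nat j) as @ [of_real (f + real j)])
                  (map (\<lambda>b. b + of_nat j) bs @ [of_real (d + f + 2 * real j)]) 1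
    = (\<Sum>k. hypergeom_coeff as bs k * of_real (p * beta_weight d f k j))" (is "?c * hypergeom ?as ?bs 1 = _")
proof -
  define h where "h k = hypergeom_coeff as bs k * of_real (p * beta_weight d f k j)" for k
  have term_eq: "?c * hypergeom_coeff ?as ?bs i = h (i + j)" for i
  proof -
    have *: "real ((j + i) choose j) = fact (j + i) / (fact i * fact j)"
      by (simp add: binomial_fact)
    have w: "complex_of_real (beta_weight d f (j + i) j) =
       fact (j + i) / (fact i * fact j) /
       (pochhammer (of_real (d + f + real j - 1)) j * pochhammer (of_real (d + f + 2 * real j)) i)
       * pochhammer (of_real (f + real j)) i"
      unfolding beta_weight_def gap_weight_def * pochhammer_of_real
      by (simp add: algebra_simps)
    have "?c * hypergeom_coeff ?as ?bs i =
        of_real p / fact j * (((\<Prod>a\<leftarrow>as. pochhammer a j) / ((\<Prod>b\<leftarrow>bs. pochhammer b j) * pochhammer (of_real (d + f + real j - 1)) j)) *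
        ((\<Prod>a\<leftarrow>as. pochhammer (a + of_nat j) i) * pochhammer (of_real (f + real j)) i /
         ((\<Prod>b\<leftarrow>bs. pochhammer (b + of_nat j) i) * pochhammer (of_real (d + f + 2 * real j)) i) / fact i))"
      by (simp add: hypergeom_coeff_def o_def mult.assoc)
    also have "\<dots> = h (i + j)"
    proof -
      have "P / F * ((A / (B * X)) * (A' * Y / (B' * Z) / I))
        = (A * A' / (B * B') / G) * (P * (G / (I * F) / (X * Z) * Y))"
        if "G \<noteq> 0" for P F A B X A' Y B' Z I G :: complex
        using that by (simp add: mult_ac)
      from this[OF fact_nonzero] show ?thesis
        unfolding h_def of_real_mult add.commute[of i j] w hypergeom_coeff_def prod_pochhammer_shift .
    qed
    finally show ?thesis .
  qed
  have "summable (\<lambda>k. norm (h k))"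
    unfolding h_def by (rule summable_norm_beta_weight[OF d f sm])
  then have smh: "summable h" by (rule summable_norm_cancel)
  then have "summable (\<lambda>i. h (i + j))" by simp
  have "(\<Sum>i. ?c * hypergeom_coeff ?as ?bs i) = ?c * (\<Sum>i. hypergeom_coeff ?as ?bs i)"
  \<comment> \<open>Convergence of the inner series is read off from that of \<open>h\<close>, which
    requires a nonzero prefactor; if it is zero, both sides are 0.\<close>
  proof (cases "?c = 0")
    case False
    have "summable (\<lambda>i. ?c * hypergeom_coeff ?as ?bs i)"
      unfolding term_eq by fact
    then have "summable (hypergeom_coeff ?as ?bs)"
      using False by (subst (asm) summable_cmult_iff) auto
    then show ?thesis by (rule suminf_mult)
  qed (simp only: mult_zero_left suminf_zero)
  then have "?c * hypergeom ?as ?bs 1 = (\<Sum>i. h (i + j))"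
    unfolding hypergeom_1 term_eq by simp
  also have "(\<lambda>i. h (i + j)) sums (\<Sum>i. h (i + j))"
    using \<open>summable (\<lambda>i. h (i + j))\<close> by (rule summable_sums)
  then have "h sums (\<Sum>i. h (i + j))"
    by (subst (asm) sums_zero_iff_shift) (auto simp: h_def beta_weight_eq_0[OF d f])
  then have "(\<Sum>i. h (i + j)) = (\<Sum>k. h k)"
    by (simp add: sums_iff)
  finally show ?thesis by (simp add: h_def)
qed

text \<open>The \<open>N\<close>-th partial sum attaches to \<open>u k\<close> a factor
  \<open>S N k\<close> between 0 and 1 that equals 1 as soon as \<open>N > k\<close>, so the
  absolutely convergent series of the \<open>u k\<close> dominates.\<close>

lemma sums_coefficient_times_hypergeom:
  fixes d f :: real
  assumes d: "d > 0" and f: "f > 0"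
  assumes sm: "summable (\<lambda>k. norm (hypergeom_coeff as bs k))"
  shows "(\<lambda>j. pochhammer (of_real d) j / fact j
             * ((\<Prod>a\<leftarrow>as. pochhammer a j)
                / ((\<Prod>b\<leftarrow>bs. pochhammer b j) * pochhammer (of_real (d + f + real j - 1)) j))
             * hypergeom (map (\<lambda>a. a + of_nat j) as @ [of_real (f + real j)])
                         (map (\<lambda>b. b + of_nat j) bs @ [of_real (d + f + 2 * real j)]) 1)
        sums hypergeom as bs 1"
proof -
  define u where "u = hypergeom_coeff as bs"
  define S where "S N k = (\<Sum>j<N. pochhammer d j * beta_weight d f k j)" for N k
  have S: "0 \<le> S N k" "S N k \<le> 1" for N k
    using d partial_sum_beta_weight_le_1[OF d f, of k N]
    by (auto simp: S_def intro!: sum_nonneg mult_nonneg_nonneg pochhammer_nonneg beta_weight_nonneg f)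
  have "(\<lambda>N. \<Sum>k. u k * of_real (S N k)) \<longlonglongrightarrow> (\<Sum>k. u k)"
  proof (rule tannerys_theorem[THEN conjunct2, THEN conjunct2])
    show "summable (\<lambda>k. norm (u k))" using sm by (simp add: u_def)
    show "(\<lambda>N. u k * of_real (S N k)) \<longlonglongrightarrow> u k" for k
      by (rule tendsto_eventually, rule eventually_mono[OF eventually_gt_at_top[of k]])
         (simp add: S_def sum_beta_weight_lessThan[OF d f])
    show "\<forall>\<^sub>F (k, N) in sequentially \<times>\<^sub>F sequentially. norm (u k * of_real (S N k)) \<le> norm (u k)"
      using S by (intro always_eventually) (auto simp: norm_mult mult_left_le)
  qed simp
  moreover have "(\<Sum>k. u k * of_real (S N k)) =
      (\<Sum>j<N. \<Sum>k. u k * of_real (pochhammer d j * beta_weight d f k j))" for N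
  proof -
    have "(\<Sum>k. u k * of_real (S N k)) = (\<Sum>k. \<Sum>j<N. u k * of_real (pochhammer d j * beta_weight d f k j))"
      by (simp add: S_def sum_distrib_left)
    also have "\<dots> = (\<Sum>j<N. \<Sum>k. u k * of_real (pochhammer d j * beta_weight d f k j))"
      unfolding u_def
      by (intro suminf_sum summable_norm_cancel[OF summable_norm_beta_weight[OF d f sm]])
    finally show ?thesis .
  qed
  ultimately have "(\<lambda>j. \<Sum>k. u k * of_real (pochhammer d j * beta_weight d f k j)) sums (\<Sum>k. u k)"
    by (simp add: sums_def)
  then show ?thesis
    unfolding u_def coefficient_times_hypergeom[OF d f sm, symmetric] hypergeom_1[symmetric]
      pochhammer_of_real[symmetric] .
qed

text \<open>Only finite sums over \<open>j\<close> are interchanged with the sum over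
  \<open>k\<close>. In the partial sum up to \<open>M\<close> the term \<open>k = 0\<close>
  contributes exactly 1, and the terms \<open>k > 0\<close> are bounded by the remainder that tends
  to 0.\<close>

lemma alternating_sums_coefficient_times_hypergeom:
  fixes d f s :: real
  assumes d: "d > 0" and f: "f > 0" and s: "s > 0" "f < d + 1 + 2 * s"
  assumes sm: "summable (\<lambda>k. norm (hypergeom_coeff as bs k))"
  assumes O: "(\<lambda>k. norm (hypergeom_coeff as bs k)) \<in> O(\<lambda>k. real k powr (- s - 1))"
  shows "(\<lambda>j. (-1) ^ j * pochhammer (of_real f) j / fact j
             * ((\<Prod>a\<leftarrow>as. pochhammer a j)
                / ((\<Prod>b\<leftarrow>bs. pochhammer b j) * pochhammer (of_real (d + f + real j - 1)) j))
             * hypergeom (map (\<lambda>a. a + of_nat j) as @ [of_real (f + real j)])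
                         (map (\<lambda>b. b + of_nat j) bs @ [of_real (d + f + 2 * real j)]) 1)
        sums 1"
proof -
  define u where "u = hypergeom_coeff as bs"
  define t where "t j k = u k * of_real ((-1) ^ j * pochhammer f j * beta_weight d f k j)" for j k
  define R where "R M n = norm (u (Suc n)) * (pochhammer f (Suc n) * real (n choose M) /
            pochhammer (d + f + real M) (Suc n))" for M n
  have smt: "summable (t j)" for j
    unfolding t_def u_def by (intro summable_norm_cancel[OF summable_norm_beta_weight[OF d f sm]])
  have bound: "norm ((\<Sum>j<Suc M. \<Sum>k. t j k) - 1) \<le> suminf (R M)" if R: "summable (R M)" for M
  proof -
    define v where "v k = (\<Sum>j<Suc M. t j k)" for k
    have v: "v k = u k * of_real (if k = 0 then 1
      else (-1) ^ M * pochhammer f k * real ((k - 1) choose M) / pochhammer (d + f + real M) k)" for k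
      unfolding v_def t_def sum_distrib_left[symmetric] of_real_sum[symmetric] lessThan_Suc_atMost
        alternating_sum_beta_weight[OF d f] ..
    have smv: "summable v" unfolding v_def by (intro summable_sum smt)
    have "(\<Sum>j<Suc M. \<Sum>k. t j k) = suminf v"
      unfolding v_def by (intro suminf_sum[symmetric] smt)
    also have "suminf v = v 0 + (\<Sum>n. v (Suc n))"
      using suminf_split_head[OF smv] by simp
    also have "v 0 = 1" by (simp add: v u_def)
    finally have "norm ((\<Sum>j<Suc M. \<Sum>k. t j k) - 1) = norm (\<Sum>n. v (Suc n))" by simp
    also have "\<dots> \<le> suminf (R M)"
    proof (rule norm_suminf_le[OF _ R])
      fix n
      have "pochhammer f (Suc n) > 0" "pochhammer (d + f + real M) (Suc n) > 0"
        using d f by (intro pochhammer_pos; simp)+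
      then show "norm (v (Suc n)) \<le> R M n"
        by (simp add: v R_def norm_mult norm_divide norm_power)
    qed
    finally show ?thesis .
  qed
  have lim: "(\<lambda>M. suminf (R M)) \<longlonglongrightarrow> 0" and ev: "\<forall>\<^sub>F M in sequentially. summable (R M)"
    using beta_remainder_tendsto_0[OF d f s, of u] O unfolding R_def u_def by auto
  have "(\<lambda>M. (\<Sum>j<Suc M. \<Sum>k. t j k) - 1) \<longlonglongrightarrow> 0"
    by (rule Lim_null_comparison[OF _ lim]) (use ev bound in \<open>auto elim!: eventually_mono\<close>)
  then have "(\<lambda>M. \<Sum>j<Suc M. \<Sum>k. t j k) \<longlonglongrightarrow> 1"
    by (subst (asm) LIM_zero_iff)
  then have "(\<lambda>M. \<Sum>j<M. \<Sum>k. t j k) \<longlonglongrightarrow> 1"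
    by (rule LIMSEQ_imp_Suc)
  then have "(\<lambda>j. \<Sum>k. t j k) sums 1" by (simp add: sums_def)
  moreover have "complex_of_real ((-1) ^ j * pochhammer f j) = (-1) ^ j * pochhammer (of_real f) j" for j
    by (simp add: pochhammer_of_real)
  ultimately show ?thesis
    unfolding t_def u_def coefficient_times_hypergeom[OF d f sm, symmetric] by simp
qed

lemma sums_one_coefficient_times_hypergeom:
  fixes as bs :: "complex list" and f d :: real
  assumes len: "length as \<le> length bs + 1"
    and bs: "\<forall>b\<in>set bs. Re b > 0"
    and s: "Re (sum_list bs - sum_list as) > 0"
    and f: "f > 0" and d: "d > 0"
    and cond: "length as \<le> length bs \<or> (\<exists>a\<in>set as. a \<in> \<int>\<^sub>\<le>\<^sub>0) \<or>
            f < d + 1 + 2 * Re (sum_list bs - sum_list as)"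
  shows "(\<lambda>j. (-1) ^ j * pochhammer (of_real f) j / fact j
             * ((\<Prod>a\<leftarrow>as. pochhammer a j)
                / ((\<Prod>b\<leftarrow>bs. pochhammer b j) * pochhammer (of_real (d + f + real j - 1)) j))
             * hypergeom (map (\<lambda>a. a + of_nat j) as @ [of_real (f + real j)])
                         (map (\<lambda>b. b + of_nat j) bs @ [of_real (d + f + 2 * real j)]) 1)
        sums 1"
proof -
  have bs': "\<forall>b\<in>set bs. b \<notin> \<int>\<^sub>\<le>\<^sub>0"
    using bs Re_pos_notin_nonpos_Ints by blast
  note sm = summable_norm_hypergeom_coeff[OF bs' len s]
  show ?thesis
  proof (cases "length as \<le> length bs \<or> (\<exists>a\<in>set as. a \<in> \<int>\<^sub>\<le>\<^sub>0)")
    case True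
    \<comment> \<open>The decay exponent is free here, and the choice \<open>s = f\<close> satisfies
      \<open>f < d + 1 + 2 s\<close> for all positive \<open>d\<close> and \<open>f\<close>.\<close>
    have "(\<lambda>k. norm (hypergeom_coeff as bs k)) \<in> O(\<lambda>k. real k powr (- f - 1))"
      by (rule hypergeom_coeff_bigo[OF bs']) (use True in auto)
    then show ?thesis
      by (intro alternating_sums_coefficient_times_hypergeom[of d f f] sm) (use d f in auto)
  next
    case False
    then have "(\<lambda>k. norm (hypergeom_coeff as bs k)) \<in> O(\<lambda>k. real k powr (- Re (sum_list bs - sum_list as) - 1))"
      by (intro hypergeom_coeff_bigo[OF bs']) (use len in auto)
    then show ?thesis
      by (intro alternating_sums_coefficient_times_hypergeom[of d f "Re (sum_list bs - sum_list as)"] sm)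
         (use False cond d f s in auto)
  qed
qed

subsection \<open>The case of Gauss's series\<close>

lemma Gamma_add_nat:
  fixes z :: complex
  assumes "z \<notin> \<int>\<^sub>\<le>\<^sub>0"
  shows "Gamma (z + of_nat n) = pochhammer z n * Gamma z"
  using pochhammer_Gamma[OF assms, of n] assms by (simp add: Gamma_eq_zero_iff)

lemma rGamma_add_nat:
  fixes z :: complex
  assumes "z \<notin> \<int>\<^sub>\<le>\<^sub>0"
  shows "rGamma (z + of_nat n) = rGamma z / pochhammer z n"
proof -
  have "pochhammer z n \<noteq> 0"
    using assms pochhammer_eq_0_imp_nonpos_Int by blast
  then show ?thesis by (subst pochhammer_rGamma[of z n]) simp
qed

text \<open>For \<open>f = c\<close> the parameter \<open>c + j\<close> occurs in both rows and
  cancels. What remains is a Gauss series whose excess \<open>c + d - a - b\<close> does not depend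
  on \<open>j\<close>.\<close>

lemma hypergeom_shifted_eq_Gamma:
  fixes a b :: complex and c d :: real
  assumes c: "c > 0" and d: "d > 0" and s: "Re (of_real (c + d) - a - b) > 0"
  shows "hypergeom (map (\<lambda>a. a + of_nat j) [a, b] @ [of_real (c + real j)])
           (map (\<lambda>b. b + of_nat j) [of_real c] @ [of_real (d + c + 2 * real j)]) 1 =
         Gamma (of_real (c + d) + of_nat (2 * j)) * Gamma (of_real (c + d) - a - b) *
         rGamma (of_real (c + d) - a + of_nat j) * rGamma (of_real (c + d) - b + of_nat j)"
proof -
  define C where "C = complex_of_real (c + d) + of_nat (2 * j)"
  have nz: "pochhammer (complex_of_real (c + real j)) i \<noteq> 0" for i
    unfolding pochhammer_of_real using pochhammer_pos[of "c + real j" i] c by simp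
  have coeff: "hypergeom_coeff (map (\<lambda>a. a + of_nat j) [a, b] @ [of_real (c + real j)])
           (map (\<lambda>b. b + of_nat j) [of_real c] @ [of_real (d + c + 2 * real j)]) i
       = gauss_term (a + of_nat j) (b + of_nat j) C i" for i
    using nz[of i] by (simp add: hypergeom_coeff_def gauss_term_def C_def add_ac)
  have C: "Re C > 0" "Re (C - (a + of_nat j) - (b + of_nat j)) > 0"
    using c d s by (simp_all add: C_def)
  have "C - (a + of_nat j) - (b + of_nat j) = of_real (c + d) - a - b"
    "C - (a + of_nat j) = of_real (c + d) - a + of_nat j"
    "C - (b + of_nat j) = of_real (c + d) - b + of_nat j"
    by (simp_all add: C_def)
  then show ?thesis
    unfolding hypergeom_1 coeff C_def[symmetric] gauss_summation[OF C] by (simp only:)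
qed

text \<open>With \<open>e = c + d - 1\<close>,
  \<open>Gamma (c + d + 2 j) = (e)_(2 j + 1) Gamma e\<close>, and
  \<open>(e)_(2 j + 1) = (e)_j (e + j)_j (e + 2 j)\<close>. The middle factor cancels the
  denominator of the prefactor, the last one is the linear factor of (ii).\<close>

lemma coefficient_times_hypergeom_2_1:
  fixes a b q :: complex and c d :: real
  assumes c: "c > 0" and d: "d > 0" and cd: "c + d \<noteq> 1"
    and s: "Re (of_real (c + d) - a - b) > 0"
    and a: "of_real (c + d) - a \<notin> \<int>\<^sub>\<le>\<^sub>0" and b: "of_real (c + d) - b \<notin> \<int>\<^sub>\<le>\<^sub>0"
  shows "q / fact j * ((\<Prod>a\<leftarrow>[a, b]. pochhammer a j)
            / ((\<Prod>b\<leftarrow>[of_real c]. pochhammer b j) * pochhammer (of_real (d + c + real j - 1)) j))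
      * hypergeom (map (\<lambda>a. a + of_nat j) [a, b] @ [of_real (c + real j)])
           (map (\<lambda>b. b + of_nat j) [of_real c] @ [of_real (d + c + 2 * real j)]) 1 =
    Gamma (of_real (c + d - 1)) * Gamma (of_real (c + d) - a - b)
       / (Gamma (of_real (c + d) - a) * Gamma (of_real (c + d) - b)) *
    (q * pochhammer a j * pochhammer b j * pochhammer (of_real (c + d - 1)) j
         * of_real (c + d + 2 * real j - 1) /
       (fact j * pochhammer (of_real c) j
          * pochhammer (of_real (d + c) - a) j * pochhammer (of_real (d + c) - b) j))"
proof -
  define e where "e = complex_of_real (c + d - 1)"
  have e: "e \<notin> \<int>\<^sub>\<le>\<^sub>0"
  proof
    assume "e \<in> \<int>\<^sub>\<le>\<^sub>0"
    then obtain n where n: "c + d - 1 = - real n"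
      unfolding e_def by (rule of_real_in_nonpos_IntsE)
    with c d have "n = 0" by simp
    with n cd show False by simp
  qed
  define P where "P = pochhammer (e + of_nat j) j"
  have P: "pochhammer (of_real (d + c + real j - 1)) j = P" "P \<noteq> 0"
  proof -
    show "pochhammer (of_real (d + c + real j - 1)) j = P"
      by (simp add: P_def e_def algebra_simps)
    show "P \<noteq> 0"
      using e pochhammer_eq_0_imp_nonpos_Int[of "e" "j + j"] pochhammer_product'[of e j j]
      by (auto simp: P_def)
  qed
  have "of_real (c + d) + of_nat (2 * j) = e + of_nat (Suc (j + j))"
    by (simp add: e_def)
  then have "Gamma (of_real (c + d) + of_nat (2 * j)) = pochhammer e (Suc (j + j)) * Gamma e"
    by (simp only: Gamma_add_nat[OF e])
  also have "pochhammer e (Suc (j + j)) = of_real (c + d + 2 * real j - 1) * (pochhammer e j * P)"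
    unfolding pochhammer_rec' pochhammer_product' P_def by (simp add: e_def algebra_simps)
  finally have G: "Gamma (of_real (c + d) + of_nat (2 * j)) =
      of_real (c + d + 2 * real j - 1) * (pochhammer e j * P) * Gamma e" .
  have gen: "q / F * (A * B / (C * P) * (X * (E * P) * \<Gamma> * \<Gamma>' * (Ra / Pa) * (Rb / Pb)))
      = \<Gamma> * \<Gamma>' * Ra * Rb * (q * A * B * E * X / (F * C * Pa * Pb))"
    for F A B C X E \<Gamma> \<Gamma>' Ra Pa Rb Pb :: complex
    using P(2) by (simp add: mult_ac)
  have x: "Gamma e * G / (Gamma u * Gamma v) = Gamma e * G * rGamma u * rGamma v" for G u v :: complex
    by (simp add: rGamma_inverse_Gamma divide_simps)
  have dc: "complex_of_real (d + c) = of_real (c + d)" by (simp add: add.commute)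
  show ?thesis
    unfolding hypergeom_shifted_eq_Gamma[OF c d s] G rGamma_add_nat[OF a] rGamma_add_nat[OF b]
      P(1) e_def[symmetric] x dc
    using gen by (simp only: list.map prod_list.Cons prod_list.Nil mult_1_right mult.assoc)
qed

text \<open>Specialisation of (i) to \<open>f = c\<close>, divided by the constant Gamma quotient,
  which is nonzero because none of its arguments is a pole. The condition of the first part is
  \<open>f < d + 1 + 2 Re (c - a - b)\<close> rewritten for \<open>f = c\<close>.\<close>

lemma gauss_transformation:
  fixes a b :: complex and c d :: real
  assumes c: "c > 0" and d: "d > 0" and cd: "c + d \<noteq> 1"
    and s: "Re (of_real c - a - b) > 0"
    and a: "of_real (c + d) - a \<notin> \<int>\<^sub>\<le>\<^sub>0" and b: "of_real (c + d) - b \<notin> \<int>\<^sub>\<le>\<^sub>0"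
  shows "a \<in> \<int>\<^sub>\<le>\<^sub>0 \<or> b \<in> \<int>\<^sub>\<le>\<^sub>0 \<or> 2 * Re (a + b) < c + d + 1 \<Longrightarrow>
          \<exists>S. (\<lambda>j. (-1) ^ j *
                  (pochhammer a j * pochhammer b j * pochhammer (of_real (c + d - 1)) j
                     * of_real (c + d + 2 * real j - 1))
                  / (fact j * pochhammer (of_real (d + c) - a) j * pochhammer (of_real (d + c) - b) j))
                sums S \<and>
               1 = Gamma (of_real (c + d - 1)) * Gamma (of_real (c + d) - a - b)
                   / (Gamma (of_real (c + d) - a) * Gamma (of_real (c + d) - b)) * S"
      (is "?cond \<Longrightarrow> \<exists>S. ?f sums S \<and> 1 = ?pref * S")
    and "\<exists>S. (\<lambda>j. (pochhammer (of_real d) j * pochhammer a j * pochhammer b j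
                   * pochhammer (of_real (c + d - 1)) j * of_real (c + d + 2 * real j - 1))
                / (fact j * pochhammer (of_real c) j
                   * pochhammer (of_real (d + c) - a) j * pochhammer (of_real (d + c) - b) j))
              sums S \<and>
             Gamma (of_real c) * Gamma (of_real c - a - b)
               / (Gamma (of_real c - a) * Gamma (of_real c - b))
             = Gamma (of_real (c + d - 1)) * Gamma (of_real (c + d) - a - b)
               / (Gamma (of_real (c + d) - a) * Gamma (of_real (c + d) - b)) * S"
      (is "\<exists>S. ?g sums S \<and> ?V = ?pref * S")
proof -
  have s': "Re (of_real (c + d) - a - b) > 0" using s d by simp
  have pref: "?pref \<noteq> 0"
  proof -
    have "complex_of_real (c + d - 1) \<notin> \<int>\<^sub>\<le>\<^sub>0"
    proof
      assume "complex_of_real (c + d - 1) \<in> \<int>\<^sub>\<le>\<^sub>0"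
      then obtain n where n: "c + d - 1 = - real n"
        by (rule of_real_in_nonpos_IntsE)
      with c d have "n = 0" by simp
      with n cd show False by simp
    qed
    with a b Re_pos_notin_nonpos_Ints[OF s'] show ?thesis
      by (simp add: Gamma_eq_zero_iff)
  qed
  have scale: "\<exists>S. h sums S \<and> V = ?pref * S" if "(\<lambda>j. ?pref * h j) sums V" for h V
  proof -
    have "(\<lambda>j. ?pref * h j) sums (?pref * (V / ?pref))"
      using that pref by simp
    then have "h sums (V / ?pref)"
      using sums_mult_iff[OF pref] by blast
    with pref show ?thesis by (intro exI[of _ "V / ?pref"]) simp
  qed
  have c': "Re (of_real c) > 0" using c by simp
  note eq = coefficient_times_hypergeom_2_1[OF c d cd s' a b]
  have lists: "length [a, b] \<le> length [complex_of_real c] + 1" "\<forall>b\<in>set [complex_of_real c]. Re b > 0"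
     "Re (sum_list [complex_of_real c] - sum_list [a, b]) > 0"
     "\<forall>b\<in>set [complex_of_real c]. b \<notin> \<int>\<^sub>\<le>\<^sub>0"
    using c s Re_pos_notin_nonpos_Ints[OF c'] by (simp_all add: algebra_simps)
  show "\<exists>S. ?f sums S \<and> 1 = ?pref * S" if ?cond
  proof (rule scale)
    have nz: "pochhammer (complex_of_real c) j \<noteq> 0" for j
      unfolding pochhammer_of_real using pochhammer_pos[OF c, of j] by simp
    have "length [a, b] \<le> length [complex_of_real c] \<or> (\<exists>x\<in>set [a, b]. x \<in> \<int>\<^sub>\<le>\<^sub>0) \<or>
            c < d + 1 + 2 * Re (sum_list [complex_of_real c] - sum_list [a, b])"
      using that by auto
    from sums_one_coefficient_times_hypergeom[OF lists(1-3) c d this] show "(\<lambda>j. ?pref * ?f j) sums 1"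
      unfolding eq by (rule sums_cong[THEN iffD1, rotated]) (simp add: nz mult_ac)
  qed
  show "\<exists>S. ?g sums S \<and> ?V = ?pref * S"
  proof (rule scale)
    \<comment> \<open>If \<open>c - a\<close> or \<open>c - b\<close> is a pole, Gamma has the value
      0 there and division by 0 gives 0, in agreement with the zero of
      \<open>rGamma\<close>.\<close>
    have "hypergeom [a, b] [of_real c] 1 = ?V"
      unfolding hypergeom_1 hypergeom_coeff_2_1 gauss_summation[OF c' s]
      by (simp add: rGamma_inverse_Gamma divide_simps)
    then show "(\<lambda>j. ?pref * ?g j) sums ?V"
      using sums_coefficient_times_hypergeom[OF d c summable_norm_hypergeom_coeff[OF lists(4,1,3)]]
      unfolding eq by simp
  qed
qed

text \<open>\<open>sums\<close> asserts convergence together with the value. With the factors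
  \<open>(f)_j / j!\<close> and \<open>(d)_j / j!\<close> the coefficient of \<open>u k\<close>
  becomes a sum of \<open>beta_weight\<close> against \<open>(-1)^j (f)_j\<close> or
  \<open>(d)_j\<close>. The extra premise of the first identities in (i) and (ii) controls the
  remainder of the alternating series. In (iii) the denominators are nonzero exactly when
  \<open>c - b - f\<close> avoids the integers from \<open>-n\<close> to \<open>n\<close>.\<close>

theorem corollary3:
  shows
    "(\<forall>(as :: complex list) (bs :: complex list) (f :: real) (d :: real).
        length as \<le> length bs + 1 \<and>
        (\<forall>b\<in>set bs. Re b > 0) \<and>
        Re (sum_list bs - sum_list as) > 0 \<and>
        f > 0 \<and> d > 0
        \<longrightarrow>
        ((length as \<le> length bs \<or> (\<exists>a\<in>set as. a \<in> \<int>\<^sub>\<le>\<^sub>0) \<or>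
            f < d + 1 + 2 * Re (sum_list bs - sum_list as))
          \<longrightarrow>
          (\<lambda>j. (-1) ^ j * pochhammer (of_real f) j / fact j
               * ((\<Prod>a\<leftarrow>as. pochhammer a j)
                  / ((\<Prod>b\<leftarrow>bs. pochhammer b j) * pochhammer (of_real (d + f + real j - 1)) j))
               * hypergeom (map (\<lambda>a. a + of_nat j) as @ [of_real (f + real j)])
                           (map (\<lambda>b. b + of_nat j) bs @ [of_real (d + f + 2 * real j)]) 1)
          sums 1) \<and>
        (\<lambda>j. pochhammer (of_real d) j / fact j
             * ((\<Prod>a\<leftarrow>as. pochhammer a j)
                / ((\<Prod>b\<leftarrow>bs. pochhammer b j) * pochhammer (of_real (d + f + real j - 1)) j))
             * hypergeom (map (\<lambda>a. a + of_nat j) as @ [of_real (f + real j)])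
                         (map (\<lambda>b. b + of_nat j) bs @ [of_real (d + f + 2 * real j)]) 1)
        sums hypergeom as bs 1)
     \<and>
     (\<forall>(a :: complex) (b :: complex) (c :: real) (d :: real).
        c > 0 \<and> d > 0 \<and> c + d \<noteq> 1 \<and> Re (of_real c - a - b) > 0 \<and>
        of_real (c + d) - a \<notin> \<int>\<^sub>\<le>\<^sub>0 \<and> of_real (c + d) - b \<notin> \<int>\<^sub>\<le>\<^sub>0
        \<longrightarrow>
        ((a \<in> \<int>\<^sub>\<le>\<^sub>0 \<or> b \<in> \<int>\<^sub>\<le>\<^sub>0 \<or> 2 * Re (a + b) < c + d + 1)
          \<longrightarrow>
          (\<exists>S. (\<lambda>j. (-1) ^ j *
                  (pochhammer a j * pochhammer b j * pochhammer (of_real (c + d - 1)) j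
                     * of_real (c + d + 2 * real j - 1))
                  / (fact j * pochhammer (of_real (d + c) - a) j * pochhammer (of_real (d + c) - b) j))
                sums S \<and>
               1 = Gamma (of_real (c + d - 1)) * Gamma (of_real (c + d) - a - b)
                   / (Gamma (of_real (c + d) - a) * Gamma (of_real (c + d) - b)) * S)) \<and>
        (\<exists>S. (\<lambda>j. (pochhammer (of_real d) j * pochhammer a j * pochhammer b j
                   * pochhammer (of_real (c + d - 1)) j * of_real (c + d + 2 * real j - 1))
                / (fact j * pochhammer (of_real c) j
                   * pochhammer (of_real (d + c) - a) j * pochhammer (of_real (d + c) - b) j))
              sums S \<and>
             Gamma (of_real c) * Gamma (of_real c - a - b)
               / (Gamma (of_real c - a) * Gamma (of_real c - b))
             = Gamma (of_real (c + d - 1)) * Gamma (of_real (c + d) - a - b)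
               / (Gamma (of_real (c + d) - a) * Gamma (of_real (c + d) - b)) * S))
     \<and>
     (\<forall>(n :: nat) (c :: complex) (b :: complex) (f :: complex).
        (\<forall>k\<le>n + 1. c - b - f \<noteq> of_nat k) \<and>
        (\<forall>j\<le>n. pochhammer (c - b - f - of_nat j) (n + 1) \<noteq> 0)
        \<longrightarrow>
        pochhammer c n =
          (\<Sum>j=0..n. (-1) ^ j * of_nat (n choose j) *
             (pochhammer b j * pochhammer f j * pochhammer (c - b) (n - j)
                * pochhammer (c - f) (n - j) * (c - b - f + of_nat n - 2 * of_nat j)
              / pochhammer (c - b - f - of_nat j) (n + 1))) \<and>
        1 =
          (\<Sum>j=0..n. (-1) ^ j * of_nat (n choose j) *
             (pochhammer b j * pochhammer (c - f) (n - j)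
                * (c - b - f + of_nat n - 2 * of_nat j)
              / pochhammer (c - b - f - of_nat j) (n + 1))))"
proof (intro conjI allI impI; elim conjE)
  fix as bs :: "complex list" and f d :: real
  assume *: "length as \<le> length bs + 1" "\<forall>b\<in>set bs. Re b > 0"
    "Re (sum_list bs - sum_list as) > 0" "f > 0" "d > 0"
  show "(\<lambda>j. pochhammer (of_real d) j / fact j
             * ((\<Prod>a\<leftarrow>as. pochhammer a j)
                / ((\<Prod>b\<leftarrow>bs. pochhammer b j) * pochhammer (of_real (d + f + real j - 1)) j))
             * hypergeom (map (\<lambda>a. a + of_nat j) as @ [of_real (f + real j)])
                         (map (\<lambda>b. b + of_nat j) bs @ [of_real (d + f + 2 * real j)]) 1)
        sums hypergeom as bs 1"
    using * Re_pos_notin_nonpos_Ints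
    by (intro sums_coefficient_times_hypergeom summable_norm_hypergeom_coeff) auto
qed (rule sums_one_coefficient_times_hypergeom gauss_transformation sum_well_poised; blast)+

end
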